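(* Let $S(L,K^2)=(G_L\backslash M)\times S(K^2)$, where $S(K^2)$ is the set of two-element subsets of $G_K\backslash M$. There are exactly seven orbits of the action of $M$ by right multiplication (elementwise) on $S(L,K^2)$. Representatives and lengths (cardinalities) of the orbits are given by: Orbit 1: representative $(3,\{p_0,p_1\})$, length $960$; Orbit 2: representative $(\overline{6},\{p_0,p_1\})$, length $960$; Orbit 3: representative $(\overline{1},\{p_0,p_1\})$, length $960$; Orbit 4: representative $(4,\{p_0,n_4\})$, length $480$; Orbit 5: representative $(\overline{4},\{p_0,n_4\})$, length $480$; Orbit 6: representative $(\overline{6},\{p_0,n_4\})$, length $1920$; Orbit 7: representative $(6,\{p_0,n_0\})$, length $192$.
   Context: $V=\{(a,b,c,d,e,f,g)^T\in\mathbb{C}^7: e+f+g-a-b-c-d=1\}$, and $\vec{x}=(a,b,c,d,e,f,g)^T$ denotes a point of $V$. Permutations in $S_7$ are identified with permutation matrices in $GL(7,\mathbb{C})$ (acting on the standard basis of $\mathbb{C}^7$). Let $A_0\in GL(7,\mathbb{C})$ be the matrix with $A_0(a,b,c,d,e,f,g)^T=(a,b,g-c,g-d,e+g-c-d,f+g-c-d,g)^T$. Put $M=\langle(12),(23),(34),(56),(67),A_0\rangle$ (order $23040$, preserving $V$; an element of $M$ is determined by its action on $V$), $G_K=\langle(23),(34),(56),(67),A_0\rangle$ (order $720$), $G_L=\langle(12),(23),(34),(67),A_0\rangle$ (order $1920$). $G_K\backslash M$ and $G_L\backslash M$ are the sets of right cosets, of sizes $32$ and $12$, on which $M$ acts by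 right multiplication. The elements $p_0,p_1,n_0,n_4$ of $G_K\backslash M$ are the right cosets of $G_K$ containing the elements of $M$ which act on $V$ by sending $\vec{x}$ to $p_0$: $(a,b,c,d,e,f,g)^T$; $p_1$: $(b,c,d,a,e,f,g)^T$; $n_0$: $(1-a,1-b,1-c,1-d,2-e,2-f,2-g)^T$; $n_4$: $(e-a,e-b,e-c,e-d,1+e-f,1+e-g,e)^T$. The $12$ elements of $G_L\backslash M$ are labelled $1,\dots,6,\overline{1},\dots,\overline{6}$; those used here are the right cosets of $G_L$ containing the elements of $M$ which act on $V$ by sending $\vec{x}$ to 6: $(a,b,c,d,e,f,g)^T$; 4: $(a,b,c,d,g,f,e)^T$; 3: $(a,1+a-e,1+a-f,1+a-g,1+a-b,1+a-c,1+a-d)^T$; $\overline{6}$: $(1-a,1-b,1-c,1-d,2-e,2-f,2-g)^T$; $\overline{4}$: $(1-a,1-b,1-c,1-d,2-g,2-f,2-e)^T$; $\overline{1}$: $(1-a,e-a,f-a,g-a,1+d-a,1+c-a,1+b-a)^T$. *)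

theory Defs
  imports "HOL-Analysis.Analysis" "HOL-Algebra.Group_Action" "HOL-Algebra.Generated_Groups"
begin

text \<open>
  The coordinates $(a,b,c,d,e,f,g)$ of a point of $C^7$ are its components at the indices
  $1,\dots,7$ of the numeral type \<^typ>\<open>7\<close> (in which \<open>7 = 0\<close>).
\<close>

definition coord_map ::
  "(complex \<Rightarrow> complex \<Rightarrow> complex \<Rightarrow> complex \<Rightarrow> complex \<Rightarrow> complex \<Rightarrow> complex \<Rightarrow> complex list)
    \<Rightarrow> complex^7 \<Rightarrow> complex^7"
  where "coord_map F x = vector (F (x $ 1) (x $ 2) (x $ 3) (x $ 4) (x $ 5) (x $ 6) (x $ 7))"

lemma vector_7 [simp]:
  fixes x1 x2 x3 x4 x5 x6 x7 :: "'a::zero"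
  defines "v \<equiv> vector [x1, x2, x3, x4, x5, x6, x7] :: 'a^7"
  shows "v $ 1 = x1" "v $ 2 = x2" "v $ 3 = x3" "v $ 4 = x4" "v $ 5 = x5" "v $ 6 = x6" "v $ 7 = x7"
  unfolding v_def vector_def by simp_all

lemma exhaust_7: "i = 1 \<or> i = 2 \<or> i = 3 \<or> i = 4 \<or> i = 5 \<or> i = 6 \<or> i = 7" for i :: 7
proof (induct i)
  case (of_int z)
  then have "z = 0 \<or> z = 1 \<or> z = 2 \<or> z = 3 \<or> z = 4 \<or> z = 5 \<or> z = 6"
    by simp arith
  then show ?case by auto
qed

lemma forall_7: "(\<forall>i::7. P i) \<longleftrightarrow> P 1 \<and> P 2 \<and> P 3 \<and> P 4 \<and> P 5 \<and> P 6 \<and> P 7"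
  by (metis exhaust_7)

definition V :: "(complex^7) set"
  where "V = {x. x $ 5 + x $ 6 + x $ 7 - x $ 1 - x $ 2 - x $ 3 - x $ 4 = 1}"

definition GL7 :: "(complex^7^7) monoid"
  where "GL7 = \<lparr>carrier = {A. invertible A}, mult = (**), one = mat 1\<rparr>"

text \<open>Sends the standard basis vector with index \<open>j\<close> to the one with index \<open>\<sigma> j\<close>.\<close>

definition perm_mat :: "(7 \<Rightarrow> 7) \<Rightarrow> complex^7^7"
  where "perm_mat \<sigma> = (\<chi> i j. if i = \<sigma> j then 1 else 0)"

abbreviation swap_mat :: "7 \<Rightarrow> 7 \<Rightarrow> complex^7^7"
  where "swap_mat i j \<equiv> perm_mat (Transposition.transpose i j)"

definition A\<^sub>0 :: "complex^7^7"
  where "A\<^sub>0 = matrix (coord_map (\<lambda>a b c d e f g.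
    [a, b, g - c, g - d, e + g - c - d, f + g - c - d, g]))"

lemma A\<^sub>0_mult: "A\<^sub>0 *v x = coord_map (\<lambda>a b c d e f g.
    [a, b, g - c, g - d, e + g - c - d, f + g - c - d, g]) x"
  unfolding A\<^sub>0_def
  by (rule matrix_works, unfold_locales)
    (simp_all add: coord_map_def vec_eq_iff forall_7 algebra_simps)

definition M_set :: "(complex^7^7) set"
  where "M_set = generate GL7
    {swap_mat 1 2, swap_mat 2 3, swap_mat 3 4, swap_mat 5 6, swap_mat 6 7, A\<^sub>0}"

definition M :: "(complex^7^7) monoid"
  where "M = GL7\<lparr>carrier := M_set\<rparr>"

definition G\<^sub>K :: "(complex^7^7) set"
  where "G\<^sub>K = generate GL7
    {swap_mat 2 3, swap_mat 3 4, swap_mat 5 6, swap_mat 6 7, A\<^sub>0}"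

definition G\<^sub>L :: "(complex^7^7) set"
  where "G\<^sub>L = generate GL7
    {swap_mat 1 2, swap_mat 2 3, swap_mat 3 4, swap_mat 6 7, A\<^sub>0}"

text \<open>
  The maps labelling the cosets are affine on $C^7$; an element of \<open>M\<close> is required to agree
  with such a map on \<open>V\<close> only. As \<open>V\<close> spans $C^7$, there is at most one such element.
\<close>

definition elt_acting_as ::
  "(complex \<Rightarrow> complex \<Rightarrow> complex \<Rightarrow> complex \<Rightarrow> complex \<Rightarrow> complex \<Rightarrow> complex \<Rightarrow> complex list)
    \<Rightarrow> complex^7^7"
  where "elt_acting_as F = (THE A. A \<in> carrier M \<and> (\<forall>x\<in>V. A *v x = coord_map F x))"

lemma matrix_determined_on_V:
  fixes A B :: "complex^7^7"
  assumes "\<forall>x\<in>V. A *v x = B *v x"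
  shows "A = B"
proof -
  define u :: "complex^7" where "u = vector [0, 0, 0, 0, 1, 0, 0]"
  define w :: "complex^7 \<Rightarrow> complex"
    where "w x = x $ 5 + x $ 6 + x $ 7 - x $ 1 - x $ 2 - x $ 3 - x $ 4" for x
  have "A *v x = B *v x" for x
  proof -
    have "u \<in> V" "x + (1 - w x) *s u \<in> V"
      by (simp_all add: V_def u_def w_def)
    then have "A *v u = B *v u" "A *v (x + (1 - w x) *s u) = B *v (x + (1 - w x) *s u)"
      using assms by blast+
    then show ?thesis
      by (simp add: matrix_vector_right_distrib matrix_vector_mult_diff_distrib
          vector_scalar_commute)
  qed
  then show ?thesis by (simp add: matrix_eq)
qed

definition K_coset ::
  "(complex \<Rightarrow> complex \<Rightarrow> complex \<Rightarrow> complex \<Rightarrow> complex \<Rightarrow> complex \<Rightarrow> complex \<Rightarrow> complex list)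
    \<Rightarrow> (complex^7^7) set"
  where "K_coset F = G\<^sub>K #>\<^bsub>M\<^esub> elt_acting_as F"

definition L_coset ::
  "(complex \<Rightarrow> complex \<Rightarrow> complex \<Rightarrow> complex \<Rightarrow> complex \<Rightarrow> complex \<Rightarrow> complex \<Rightarrow> complex list)
    \<Rightarrow> (complex^7^7) set"
  where "L_coset F = G\<^sub>L #>\<^bsub>M\<^esub> elt_acting_as F"

definition p\<^sub>0 :: "(complex^7^7) set"
  where "p\<^sub>0 = K_coset (\<lambda>a b c d e f g. [a, b, c, d, e, f, g])"

definition p\<^sub>1 :: "(complex^7^7) set"
  where "p\<^sub>1 = K_coset (\<lambda>a b c d e f g. [b, c, d, a, e, f, g])"

definition n\<^sub>0 :: "(complex^7^7) set"
  where "n\<^sub>0 = K_coset (\<lambda>a b c d e f g.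
    [1 - a, 1 - b, 1 - c, 1 - d, 2 - e, 2 - f, 2 - g])"

definition n\<^sub>4 :: "(complex^7^7) set"
  where "n\<^sub>4 = K_coset (\<lambda>a b c d e f g.
    [e - a, e - b, e - c, e - d, 1 + e - f, 1 + e - g, e])"

definition l6 :: "(complex^7^7) set"
  where "l6 = L_coset (\<lambda>a b c d e f g. [a, b, c, d, e, f, g])"

definition l4 :: "(complex^7^7) set"
  where "l4 = L_coset (\<lambda>a b c d e f g. [a, b, c, d, g, f, e])"

definition l3 :: "(complex^7^7) set"
  where "l3 = L_coset (\<lambda>a b c d e f g.
    [a, 1 + a - e, 1 + a - f, 1 + a - g, 1 + a - b, 1 + a - c, 1 + a - d])"

definition l6bar :: "(complex^7^7) set"
  where "l6bar = L_coset (\<lambda>a b c d e f g.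
    [1 - a, 1 - b, 1 - c, 1 - d, 2 - e, 2 - f, 2 - g])"

definition l4bar :: "(complex^7^7) set"
  where "l4bar = L_coset (\<lambda>a b c d e f g.
    [1 - a, 1 - b, 1 - c, 1 - d, 2 - g, 2 - f, 2 - e])"

definition l1bar :: "(complex^7^7) set"
  where "l1bar = L_coset (\<lambda>a b c d e f g.
    [1 - a, e - a, f - a, g - a, 1 + d - a, 1 + c - a, 1 + b - a])"

definition S_LK2 :: "((complex^7^7) set \<times> (complex^7^7) set set) set"
  where "S_LK2 = (rcosets\<^bsub>M\<^esub> G\<^sub>L) \<times> {P. P \<subseteq> rcosets\<^bsub>M\<^esub> G\<^sub>K \<and> card P = 2}"

text \<open>
  This is a right action; \<^const>\<open>orbit\<close> and \<^const>\<open>orbits\<close> only collect the images under all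
  \<open>m\<close> in \<open>M\<close>, so they can be used for it unchanged.
\<close>

definition right_mult ::
  "complex^7^7 \<Rightarrow> (complex^7^7) set \<times> (complex^7^7) set set
    \<Rightarrow> (complex^7^7) set \<times> (complex^7^7) set set"
  where "right_mult m = (\<lambda>(C, P). (C #>\<^bsub>M\<^esub> m, (\<lambda>D. D #>\<^bsub>M\<^esub> m) ` P))"

abbreviation M_orbit ::
  "(complex^7^7) set \<times> (complex^7^7) set set \<Rightarrow> ((complex^7^7) set \<times> (complex^7^7) set set) set"
  where "M_orbit \<equiv> orbit M right_mult"

end

theory Submission
  imports Defs "HOL-Combinatorics.Permutations"
begin

text \<open>
  In suitable coordinates \<open>M\<close> is the group of signed permutations of six letters with an even number
  of sign changes. The cosets of \<open>G\<^sub>L\<close> become the twelve signed letters, those of \<open>G\<^sub>K\<close> the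
  32 sets that contain exactly one of \<open>i\<close> and \<open>- i\<close> for each letter, with an even number of negative
  elements. For a signed letter \<open>i\<close> and a pair of such sets with intersection \<open>K\<close>, the size of \<open>K\<close>
  and the position of \<open>i\<close> (in \<open>K\<close>, in \<open>- K\<close>, or in neither) are invariant; as any bijection
  between two of the sets extends to an element of the group, they determine the orbit. With
  $k = |K| \in \{0, 2, 4\}$ there are $16 \binom{6}{k}$ pairs, and $k$, $k$, $12 - 2k$ letters for
  the three positions.
\<close>

section \<open>Signed permutations and even transversals\<close>

text \<open>The two kinds of cosets come from two invariant functionals. \<open>G\<^sub>K\<close>
  fixes the first coordinate a, and \<open>2 * level - 4 * a\<close> is the sum of the six positive
  weights; \<open>G\<^sub>L\<close> fixes \<open>weight 6\<close>. The images of these functionals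
  under \<open>M\<close> are the sums of weights over even transversals and the signed weights. Only
  one member of a pair has to be moved by hand: the other consists of K and the negatives of the
  rest of the first, so an odd map that is right on the first member and on K is right on the
  second. The two members differ by 6 - k sign changes, hence k is even, and k = 6 would make them
  equal. For k = 0 a letter can only lie in neither K nor its negative, which leaves 3 + 3 + 1 = 7
  orbits. Two mismatches shape the formal side. Weights are pulled back along matrices, so the
  matrix product reverses composition, and right multiplication of cosets becomes the ordinary
  action of signed permutations. The labelling maps are affine while elements of \<open>M\<close>
  are linear; they are compared on V, where the level is 1 and absorbs the constants.\<close>

definition signed :: "int set"
  where "signed = {i. i \<noteq> 0 \<and> \<bar>i\<bar> \<le> 6}"

definition positives :: "int set"
  where "positives = {1..6}"

definition transversal :: "int set \<Rightarrow> bool"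
  where "transversal T \<longleftrightarrow> T \<subseteq> signed \<and> (\<forall>i\<in>signed. i \<in> T \<longleftrightarrow> - i \<notin> T)"

text \<open>The positive letters missing from T are the negatives of its negative elements. Counting
  them as \<open>positives - T\<close> makes the parity a special case of comparing two
  transversals.\<close>

definition even_transversals :: "int set set"
  where "even_transversals = {T. transversal T \<and> even (card (positives - T))}"

text \<open>\<open>permutes\<close> fixes every integer outside \<open>signed\<close>, so distinct
  functions represent distinct group elements.\<close>

definition signed_perms :: "(int \<Rightarrow> int) set"
  where "signed_perms = {\<pi>. \<pi> permutes signed \<and> (\<forall>i. \<pi> (- i) = - \<pi> i)}"

text \<open>The sign changes of \<pi> are counted by the negative elements in the image of the
  positive letters.\<close>

definition even_perms :: "(int \<Rightarrow> int) set"
  where "even_perms = {\<pi> \<in> signed_perms. \<pi> ` positives \<in> even_transversals}"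

lemma positives_eq: "positives = {1, 2, 3, 4, 5, 6}"
  unfolding positives_def by auto

lemma signed_eq: "signed = {1, 2, 3, 4, 5, 6, -1, -2, -3, -4, -5, -6}"
proof -
  have "i \<in> signed \<longleftrightarrow> i \<in> {1..6} \<or> i \<in> {-6..-1}" for i
    by (auto simp: signed_def)
  moreover have "{1..6::int} = {1, 2, 3, 4, 5, 6}" "{-6..-1::int} = {-1, -2, -3, -4, -5, -6}"
    by auto
  ultimately show ?thesis by auto
qed

lemma finite_signed [simp]: "finite signed"
  by (simp add: signed_eq)

lemma uminus_signed [simp]: "- i \<in> signed \<longleftrightarrow> i \<in> signed"
  by (auto simp: signed_def)

lemma transversalD:
  assumes "transversal T"
  shows "T \<subseteq> signed" "i \<in> T \<Longrightarrow> - i \<notin> T" "i \<in> signed \<Longrightarrow> i \<notin> T \<Longrightarrow> - i \<in> T"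
  using assms unfolding transversal_def by blast+

lemma finite_transversal: "transversal T \<Longrightarrow> finite T"
  using finite_subset[OF transversalD(1) finite_signed] .

lemma transversal_positives: "transversal positives"
  by (auto simp: transversal_def positives_def signed_def)

text \<open>A letter of T' outside T is the negative of a letter of T that T' omits. Hence T and the
  intersection determine T'.\<close>

lemma transversal_eq_flip:
  assumes T: "transversal T" and T': "transversal T'"
  shows "T' = (T \<inter> T') \<union> uminus ` (T - T')"
proof (intro Set.set_eqI iffI)
  fix i assume i: "i \<in> T'"
  then have "i \<in> signed" using transversalD(1)[OF T'] by blast
  then have "i \<in> T \<or> - i \<in> T - T'"
    using transversalD(3)[OF T] transversalD(2)[OF T' i] by blast
  then show "i \<in> (T \<inter> T') \<union> uminus ` (T - T')"
    using i by (auto simp: image_iff intro: bexI[of _ "- i"])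
next
  fix i assume "i \<in> (T \<inter> T') \<union> uminus ` (T - T')"
  then show "i \<in> T'"
    using transversalD(1)[OF T] transversalD(3)[OF T'] by auto
qed

lemma transversal_flip:
  assumes T: "transversal T" and K: "K \<subseteq> T"
  shows "transversal (K \<union> uminus ` (T - K))" "T \<inter> (K \<union> uminus ` (T - K)) = K"
proof -
  have mem: "i \<in> uminus ` (T - K) \<longleftrightarrow> - i \<in> T \<and> - i \<notin> K" for i
    by (auto simp: image_iff intro: bexI[of _ "- i"])
  show "transversal (K \<union> uminus ` (T - K))"
    unfolding transversal_def
  proof (rule conjI; (rule ballI)?)
    show "K \<union> uminus ` (T - K) \<subseteq> signed"
      using transversalD(1)[OF T] K by auto
    fix i assume "i \<in> signed"
    then show "i \<in> K \<union> uminus ` (T - K) \<longleftrightarrow> - i \<notin> K \<union> uminus ` (T - K)"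
      using transversalD(2)[OF T, of i] transversalD(3)[OF T, of i] K by (auto simp: mem)
  qed
  show "T \<inter> (K \<union> uminus ` (T - K)) = K"
    using transversalD(2)[OF T] K by (auto simp: mem)
qed

text \<open>Negation maps \<open>(A - B) \<inter> C\<close> onto \<open>B - A - C\<close>, so
  \<open>card (A - B) + card (B - C)\<close> exceeds \<open>card (A - C)\<close> by the even number
  \<open>2 * card (B - A - C)\<close>. The parity of the difference thus splits the transversals
  into two classes.\<close>

lemma transversal_parity:
  assumes A: "transversal A" and B: "transversal B" and C: "transversal C"
  shows "even (card (A - C)) \<longleftrightarrow> (even (card (A - B)) \<longleftrightarrow> even (card (B - C)))"
proof -
  have fin: "finite A" "finite B" "finite C"
    using assms by (auto intro: finite_transversal)
  have "card (A - C) = card ((A \<inter> B - C) \<union> (A - B - C))"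
    by (rule arg_cong[of _ _ card]) blast
  then have 1: "card (A - C) = card (A \<inter> B - C) + card (A - B - C)"
    using fin by (subst (asm) card_Un_disjoint) auto
  have "card (B - C) = card ((A \<inter> B - C) \<union> (B - A - C))"
    by (rule arg_cong[of _ _ card]) blast
  then have 2: "card (B - C) = card (A \<inter> B - C) + card (B - A - C)"
    using fin by (subst (asm) card_Un_disjoint) auto
  have "card (A - B) = card ((A - B - C) \<union> (A - B) \<inter> C)"
    by (rule arg_cong[of _ _ card]) blast
  then have 3: "card (A - B) = card (A - B - C) + card ((A - B) \<inter> C)"
    using fin by (subst (asm) card_Un_disjoint) auto
  have "B - A - C = uminus ` ((A - B) \<inter> C)"
  proof (intro Set.set_eqI iffI)
    fix i assume i: "i \<in> B - A - C"
    then have "i \<in> signed" using transversalD(1)[OF B] by blast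
    then have "- i \<in> (A - B) \<inter> C"
      using i transversalD(3)[OF A] transversalD(2)[OF B, of i] transversalD(3)[OF C] by auto
    then show "i \<in> uminus ` ((A - B) \<inter> C)" by force
  next
    fix i assume "i \<in> uminus ` ((A - B) \<inter> C)"
    then show "i \<in> B - A - C"
      using transversalD(1,2)[OF A] transversalD(3)[OF B] transversalD(2)[OF C] by auto
  qed
  then have "card (B - A - C) = card ((A - B) \<inter> C)"
    by (simp add: card_image)
  then show ?thesis using 1 2 3 by (simp, blast)
qed

lemma even_transversals_iff:
  assumes "A \<in> even_transversals" "transversal B"
  shows "B \<in> even_transversals \<longleftrightarrow> even (card (A - B))"
  using assms transversal_parity[OF transversal_positives, of A B] by (auto simp: even_transversals_def)

lemma positives_even: "positives \<in> even_transversals"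
  by (simp add: even_transversals_def transversal_positives)

section \<open>Action of signed permutations on transversals\<close>

lemma signed_permsD:
  assumes "\<pi> \<in> signed_perms"
  shows "\<pi> permutes signed" "\<pi> (- i) = - \<pi> i" "inj \<pi>" "bij \<pi>" "\<pi> i \<in> signed \<longleftrightarrow> i \<in> signed"
proof -
  show perm: "\<pi> permutes signed" and "\<pi> (- i) = - \<pi> i"
    using assms by (simp_all add: signed_perms_def)
  show "inj \<pi>" "bij \<pi>" "\<pi> i \<in> signed \<longleftrightarrow> i \<in> signed"
    using permutes_inj[OF perm] permutes_bij[OF perm] permutes_in_image[OF perm] by simp_all
qed

lemma signed_perms_comp:
  "\<pi> \<in> signed_perms \<Longrightarrow> \<sigma> \<in> signed_perms \<Longrightarrow> \<sigma> \<circ> \<pi> \<in> signed_perms"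
  by (auto simp: signed_perms_def intro: permutes_compose)

lemma signed_perms_inv:
  assumes "\<pi> \<in> signed_perms"
  shows "inv_into UNIV \<pi> \<in> signed_perms"
proof -
  have "inv_into UNIV \<pi> (- i) = - inv_into UNIV \<pi> i" for i
    using signed_permsD(1,2)[OF assms] by (metis permutes_inverses(1) permutes_inv_eq)
  then show ?thesis
    using signed_permsD(1)[OF assms] by (simp add: signed_perms_def permutes_inv)
qed

lemma transversal_image:
  assumes "\<pi> \<in> signed_perms" "transversal T"
  shows "transversal (\<pi> ` T)"
proof -
  note \<pi> = signed_permsD[OF assms(1)]
  have "\<pi> ` T \<subseteq> signed"
    using \<pi>(5) transversalD(1)[OF assms(2)] by auto
  moreover have "i \<in> \<pi> ` T \<longleftrightarrow> - i \<notin> \<pi> ` T" if i: "i \<in> signed" for i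
  proof -
    obtain j where j: "i = \<pi> j" using bij_is_surj[OF \<pi>(4)] by (metis surjD)
    then have "j \<in> signed" "- i = \<pi> (- j)" using \<pi>(2,5) i by auto
    then show ?thesis
      using j inj_image_mem_iff[OF \<pi>(3)] transversalD(2)[OF assms(2), of j]
        transversalD(3)[OF assms(2), of j] by auto
  qed
  ultimately show ?thesis unfolding transversal_def by blast
qed

lemma even_perms_image:
  assumes \<pi>: "\<pi> \<in> even_perms" and T: "T \<in> even_transversals"
  shows "\<pi> ` T \<in> even_transversals"
proof -
  have s: "\<pi> \<in> signed_perms" "\<pi> ` positives \<in> even_transversals"
    using \<pi> by (auto simp: even_perms_def)
  have t: "transversal T" using T by (simp add: even_transversals_def)
  have "\<pi> ` positives - \<pi> ` T = \<pi> ` (positives - T)"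
    using image_set_diff[OF signed_permsD(3)[OF s(1)]] by simp
  then have "card (\<pi> ` positives - \<pi> ` T) = card (positives - T)"
    using signed_permsD(3)[OF s(1)] by (simp add: card_image inj_on_subset)
  then show ?thesis
    using even_transversals_iff[OF s(2) transversal_image[OF s(1) t]] T
    by (simp add: even_transversals_def)
qed

text \<open>An injective map preserves the sizes of differences, so a signed permutation either
  preserves both parity classes or exchanges them; one even transversal with even image
  decides.\<close>

lemma even_permsI:
  assumes \<pi>: "\<pi> \<in> signed_perms" and T: "T \<in> even_transversals" "\<pi> ` T \<in> even_transversals"
  shows "\<pi> \<in> even_perms"
proof -
  have t: "transversal T" using T by (simp add: even_transversals_def)
  have "\<pi> ` T - \<pi> ` positives = \<pi> ` (T - positives)"
    using image_set_diff[OF signed_permsD(3)[OF \<pi>]] by simp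
  then have "card (\<pi> ` T - \<pi> ` positives) = card (T - positives)"
    using signed_permsD(3)[OF \<pi>] by (simp add: card_image inj_on_subset)
  then have "\<pi> ` positives \<in> even_transversals"
    using even_transversals_iff[OF T(2) transversal_image[OF \<pi> transversal_positives]]
      even_transversals_iff[OF T(1) transversal_positives] positives_even by simp
  then show ?thesis using \<pi> by (simp add: even_perms_def)
qed

lemma even_perms_signed: "\<pi> \<in> even_perms \<Longrightarrow> \<pi> \<in> signed_perms"
  by (simp add: even_perms_def)

lemma even_perms_id: "id \<in> even_perms"
  by (simp add: even_perms_def signed_perms_def positives_even)

lemma even_perms_comp:
  assumes "\<pi> \<in> even_perms" "\<sigma> \<in> even_perms"
  shows "\<sigma> \<circ> \<pi> \<in> even_perms"
proof (rule even_permsI[where T = positives])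
  have "(\<sigma> \<circ> \<pi>) ` positives = \<sigma> ` (\<pi> ` positives)"
    by (simp only: image_comp)
  then show "(\<sigma> \<circ> \<pi>) ` positives \<in> even_transversals"
    using assms by (simp add: even_perms_image positives_even)
qed (use assms in \<open>simp_all add: even_perms_signed signed_perms_comp positives_even\<close>)

lemma even_perms_inv:
  assumes "\<pi> \<in> even_perms"
  shows "inv_into UNIV \<pi> \<in> even_perms"
proof (rule even_permsI)
  show "inv_into UNIV \<pi> \<in> signed_perms"
    using assms by (simp add: even_perms_signed signed_perms_inv)
  show "\<pi> ` positives \<in> even_transversals"
    using assms by (simp add: even_perms_def)
  show "inv_into UNIV \<pi> ` \<pi> ` positives \<in> even_transversals"
    using signed_permsD(3)[OF even_perms_signed[OF assms]] by (simp add: inv_f_f image_comp positives_even)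
qed

section \<open>Extending bijections between transversals\<close>

lemma card_transversal:
  assumes "transversal T"
  shows "card T = 6"
proof -
  have "signed = T \<union> uminus ` T"
  proof (intro Set.set_eqI iffI)
    fix i assume "i \<in> signed"
    then show "i \<in> T \<union> uminus ` T"
      using transversalD(3)[OF assms, of i] by (force simp: image_iff)
  qed (use transversalD(1)[OF assms] in auto)
  moreover have "T \<inter> uminus ` T = {}"
    using transversalD(2)[OF assms] by auto
  ultimately have "card signed = card T + card (uminus ` T)"
    using finite_transversal[OF assms] by (metis card_Un_disjoint finite_imageI)
  moreover have "card signed = 12"
    by (simp add: signed_eq)
  ultimately show ?thesis by (simp add: card_image)
qed

lemma bij_betw_point:
  assumes "finite A" "finite B" "card A = card B" "a \<in> A" "b \<in> B"
  obtains f where "bij_betw f A B" "f a = b"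
proof -
  have "card (A - {a}) = card (B - {b})"
    using assms by simp
  then obtain g where "bij_betw g (A - {a}) (B - {b})"
    using finite_same_card_bij[of "A - {a}" "B - {b}"] assms(1,2) by auto
  then have "bij_betw (g(a := b)) (A - {a}) (B - {b})"
    using bij_betw_cong[of "A - {a}" "g(a := b)" g "B - {b}"] by simp
  moreover have "bij_betw (g(a := b)) {a} {b}" by (simp add: bij_betw_def)
  ultimately have "bij_betw (g(a := b)) ((A - {a}) \<union> {a}) ((B - {b}) \<union> {b})"
    by (intro bij_betw_combine) auto
  then have "bij_betw (g(a := b)) A B"
    using assms(4,5) by (simp add: insert_absorb)
  then show ?thesis by (rule that) simp
qed

text \<open>Bijections of K onto L and of the complements are glued; the condition on the point goes
  into whichever of the two has a in its domain.\<close>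

lemma bij_betw_subset_point:
  assumes fin: "finite A" "finite B" and card: "card A = card B"
    and K: "K \<subseteq> A" "L \<subseteq> B" "card K = card L"
    and a: "a \<in> A" "b \<in> B" "a \<in> K \<longleftrightarrow> b \<in> L"
  obtains f where "bij_betw f A B" "f ` K = L" "f a = b"
proof -
  have finK: "finite K" "finite L" "finite (A - K)" "finite (B - L)"
    using fin K by (auto intro: finite_subset)
  have card': "card (A - K) = card (B - L)"
    using fin card K finK by (simp add: card_Diff_subset)
  obtain f g where f: "bij_betw f K L" and g: "bij_betw g (A - K) (B - L)"
    and fg: "(if a \<in> K then f a else g a) = b"
  proof (cases "a \<in> K")
    case True
    then obtain f where "bij_betw f K L" "f a = b"
      using bij_betw_point[OF finK(1,2) K(3), of a b] a by metis
    moreover obtain g where "bij_betw g (A - K) (B - L)"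
      using finite_same_card_bij[OF finK(3,4) card'] by blast
    ultimately show ?thesis using True that by auto
  next
    case False
    then obtain g where "bij_betw g (A - K) (B - L)" "g a = b"
      using bij_betw_point[OF finK(3,4) card', of a b] a by (metis Diff_iff)
    moreover obtain f where "bij_betw f K L"
      using finite_same_card_bij[OF finK(1,2) K(3)] by blast
    ultimately show ?thesis using False that by auto
  qed
  define h where "h x = (if x \<in> K then f x else g x)" for x
  have hK: "bij_betw h K L"
    using f bij_betw_cong[of K h f L] by (simp add: h_def)
  have "bij_betw h (A - K) (B - L)"
    using g bij_betw_cong[of "A - K" h g "B - L"] by (simp add: h_def)
  then have "bij_betw h (K \<union> (A - K)) (L \<union> (B - L))"
    by (intro bij_betw_combine hK) auto
  then have "bij_betw h A B"
    using K by (simp add: Un_absorb1)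
  moreover have "h ` K = L" using hK by (simp add: bij_betw_def)
  moreover have "h a = b" using fg by (simp add: h_def)
  ultimately show ?thesis by (rule that)
qed

text \<open>Oddness forces the values on the negatives of T, and T together with its negatives
  exhausts \<open>signed\<close>. Evenness is automatic, since T and its image are both
  even.\<close>

lemma even_perms_extend:
  assumes T: "T \<in> even_transversals" "T' \<in> even_transversals" and f: "bij_betw f T T'"
  obtains \<pi> where "\<pi> \<in> even_perms" "\<And>x. x \<in> T \<Longrightarrow> \<pi> x = f x"
proof -
  have t: "transversal T" and t': "transversal T'"
    using T by (auto simp: even_transversals_def)
  have fT': "f x \<in> T'" if "x \<in> T" for x
    using f that by (auto simp: bij_betw_def)
  define \<pi> where "\<pi> x = (if x \<in> T then f x else if - x \<in> T then - f (- x) else x)" for x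
  have \<pi>T: "\<pi> x = f x" if "x \<in> T" for x
    using that by (simp add: \<pi>_def)
  have odd: "\<pi> (- x) = - \<pi> x" for x
    using transversalD(2)[OF t, of x] transversalD(2)[OF t, of "- x"] by (auto simp: \<pi>_def)
  have in_T: "\<pi> x \<in> T' \<longleftrightarrow> x \<in> T" if "x \<in> signed" for x
    using that fT'[of x] fT'[of "- x"] transversalD(3)[OF t, of x] transversalD(2)[OF t', of "f (- x)"]
    by (auto simp: \<pi>_def)
  have "\<pi> permutes signed"
  proof (rule inj_imp_permutes)
    show "inj_on \<pi> signed"
    proof (rule inj_onI)
      fix x y assume xy: "x \<in> signed" "y \<in> signed" "\<pi> x = \<pi> y"
      then have "x \<in> T \<longleftrightarrow> y \<in> T" using in_T by metis
      then show "x = y"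
        using xy transversalD(3)[OF t xy(1)] transversalD(3)[OF t xy(2)]
          bij_betw_imp_inj_on[OF f]
        by (cases "x \<in> T") (auto simp: \<pi>_def inj_on_eq_iff)
    qed
    show "\<pi> x \<in> signed" if "x \<in> signed" for x
      using that fT'[of x] fT'[of "- x"] transversalD(1)[OF t'] by (auto simp: \<pi>_def)
    show "\<pi> x = x" if "x \<notin> signed" for x
      using that transversalD(1)[OF t] by (auto simp: \<pi>_def)
  qed simp
  then have "\<pi> \<in> signed_perms"
    using odd by (simp add: signed_perms_def)
  moreover have "\<pi> ` T = T'"
    using f \<pi>T by (simp add: bij_betw_def)
  ultimately show ?thesis
    using that even_permsI T \<pi>T by metis
qed

text \<open>The single source of transitivity: K is an intersection of two transversals when pairs
  are moved, and empty when only a letter or a transversal is moved.\<close>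

lemma even_perms_exists:
  assumes T: "T \<in> even_transversals" "T' \<in> even_transversals"
    and K: "K \<subseteq> T" "K' \<subseteq> T'" "card K = card K'"
    and j: "j \<in> T" "j' \<in> T'" "j \<in> K \<longleftrightarrow> j' \<in> K'"
  obtains \<pi> where "\<pi> \<in> even_perms" "\<pi> ` T = T'" "\<pi> ` K = K'" "\<pi> j = j'"
proof -
  have t: "transversal T" "transversal T'"
    using T by (auto simp: even_transversals_def)
  obtain f where f: "bij_betw f T T'" "f ` K = K'" "f j = j'"
    by (rule bij_betw_subset_point[OF finite_transversal[OF t(1)] finite_transversal[OF t(2)] _ K j])
      (simp add: card_transversal t)
  obtain \<pi> where \<pi>: "\<pi> \<in> even_perms" "\<And>x. x \<in> T \<Longrightarrow> \<pi> x = f x"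
    using even_perms_extend[OF T f(1)] by metis
  moreover have "\<pi> ` T = T'"
    using f(1) \<pi>(2) by (simp add: bij_betw_def)
  moreover have "\<pi> ` K = K'"
    using f(2) \<pi>(2) K(1) by (metis image_cong subsetD)
  ultimately show ?thesis
    using that \<pi>(2)[OF j(1)] f(3) by metis
qed

section \<open>Generation by reflections\<close>

definition signed_swap :: "int \<Rightarrow> int \<Rightarrow> int \<Rightarrow> int"
  where "signed_swap i j k = (if k = i then j else if k = j then i
    else if k = - i then - j else if k = - j then - i else k)"

lemma signed_swap_involution:
  assumes "i \<in> signed" "j \<in> signed" "i \<noteq> - j"
  shows "signed_swap i j (signed_swap i j k) = k"
  using assms unfolding signed_swap_def by (simp add: signed_def)

lemma signed_swap_signed_perms:
  assumes "i \<in> signed" "j \<in> signed" "i \<noteq> - j"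
  shows "signed_swap i j \<in> signed_perms"
proof -
  have "\<exists>!x. signed_swap i j x = y" for y
    by (metis signed_swap_involution[OF assms])
  moreover have "signed_swap i j x = x" if "x \<notin> signed" for x
    using that assms by (auto simp: signed_swap_def)
  ultimately have "signed_swap i j permutes signed"
    by (simp add: permutes_def)
  moreover have "signed_swap i j (- k) = - signed_swap i j k" for k
    using assms unfolding signed_swap_def signed_def by (smt (verit) mem_Collect_eq)
  ultimately show ?thesis by (simp add: signed_perms_def)
qed

lemma signed_swap_positives:
  assumes "i \<in> positives" "j \<in> positives"
  shows "signed_swap i j ` positives = positives"
proof -
  have "signed_swap i j k \<in> positives" if "k \<in> positives" for k
    using assms that by (auto simp: signed_swap_def positives_def)
  moreover have "signed_swap i j (signed_swap i j k) = k" for k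
    using assms by (intro signed_swap_involution) (auto simp: signed_def positives_def)
  ultimately show ?thesis by (metis image_subsetI image_eqI subsetI subset_antisym)
qed

lemma signed_swap_even_perms:
  assumes "i \<in> positives" "j \<in> positives"
  shows "signed_swap i j \<in> even_perms"
proof -
  have "signed_swap i j \<in> signed_perms"
    using assms by (intro signed_swap_signed_perms) (auto simp: signed_def positives_def)
  then show ?thesis
    using signed_swap_positives[OF assms] positives_even by (simp add: even_perms_def)
qed

text \<open>This reflection sends 1 to -2 and 2 to -1, which makes two sign changes. It is the
  simple reflection of $D_6$ that is not an adjacent swap.\<close>

lemma signed_swap_neg_even_perms: "signed_swap 1 (- 2) \<in> even_perms"
proof -
  have s: "signed_swap 1 (- 2) \<in> signed_perms"
    by (intro signed_swap_signed_perms) (auto simp: signed_def)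
  have "positives - signed_swap 1 (- 2) ` positives = {1, 2}"
    by (auto simp: positives_eq signed_swap_def)
  then show ?thesis
    using s transversal_image[OF s transversal_positives]
    by (simp add: even_perms_def even_transversals_def)
qed

text \<open>
  The adjacent swaps move \<open>\<pi> n\<close> up to \<open>n\<close>, after passing through \<open>signed_swap 1 (- 2)\<close> if
  \<open>\<pi> n\<close> is negative; then \<open>n\<close> is fixed and the induction on \<open>n\<close> applies.
\<close>

lemma even_perms_generated:
  fixes n :: nat
  assumes id: "id \<in> S"
    and comp: "\<And>\<pi> \<sigma>. \<pi> \<in> S \<Longrightarrow> \<sigma> \<in> S \<Longrightarrow> \<sigma> \<circ> \<pi> \<in> S"
    and swap: "\<And>k. 1 \<le> k \<Longrightarrow> k < int n \<Longrightarrow> signed_swap k (k + 1) \<in> S"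
    and n: "1 \<le> n" "n \<le> 6"
    and \<pi>: "\<pi> \<in> even_perms" "\<And>i. \<bar>i\<bar> > int n \<Longrightarrow> \<pi> i = i"
    and neg: "signed_swap 1 (- 2) \<in> S \<or> \<pi> ` positives = positives"
  shows "\<pi> \<in> S"
  using n swap \<pi> neg
proof (induction n arbitrary: \<pi> rule: nat_induct_at_least)
  case base
  note s = even_perms_signed[OF base.prems(3)]
  have "\<pi> 1 \<in> signed" using signed_permsD(5)[OF s] by (simp add: signed_def)
  moreover have "\<not> \<bar>\<pi> 1\<bar> > 1"
  proof
    assume "\<bar>\<pi> 1\<bar> > 1"
    then have "\<pi> (\<pi> 1) = \<pi> 1" using base.prems(4) by simp
    then have "\<pi> 1 = 1" using signed_permsD(3)[OF s] by (simp add: inj_eq)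
    then show False using \<open>\<bar>\<pi> 1\<bar> > 1\<close> by simp
  qed
  ultimately have "\<pi> 1 = 1 \<or> \<pi> 1 = - 1" by (auto simp: signed_def)
  \<comment> \<open>Changing the sign of 1 alone is odd, so only the identity remains in the base
    case.\<close>
  moreover have "\<pi> 1 \<noteq> - 1"
  proof
    assume "\<pi> 1 = - 1"
    moreover have "\<pi> i = i" if "i \<in> {2, 3, 4, 5, 6}" for i
      using base.prems(4)[of i] that by auto
    ultimately have "\<pi> ` positives = {- 1, 2, 3, 4, 5, 6}"
      by (simp add: positives_eq)
    moreover have "positives - {- 1, 2, 3, 4, 5, 6} = {1}" by (auto simp: positives_eq)
    ultimately show False using base.prems(3) by (simp add: even_perms_def even_transversals_def)
  qed
  ultimately have "\<pi> 1 = 1" by simp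
  moreover have "\<pi> 0 = 0" using signed_permsD(2)[OF s, of 0] by simp
  moreover have "\<pi> (- 1) = - 1" using \<open>\<pi> 1 = 1\<close> signed_permsD(2)[OF s, of 1] by simp
  moreover have "i = 0 \<or> i = 1 \<or> i = - 1 \<or> \<bar>i\<bar> > 1" for i :: int by arith
  ultimately have "\<pi> i = i" for i
    using base.prems(4)[of i] by (metis of_nat_1)
  then have "\<pi> = id" by auto
  then show ?case using id by (simp only:)
next
  case (Suc n)
  define N where "N = int (Suc n)"
  have N: "2 \<le> N" "N \<le> 6" using Suc.hyps Suc.prems(1) by (auto simp: N_def)
  have step: "\<pi> \<in> S"
    if \<pi>: "\<pi> \<in> even_perms" "\<And>i. \<bar>i\<bar> > N \<Longrightarrow> \<pi> i = i"
      "signed_swap 1 (- 2) \<in> S \<or> \<pi> ` positives = positives" "\<pi> N = N" for \<pi>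
  proof (rule Suc.IH)
    show "\<pi> i = i" if "\<bar>i\<bar> > int n" for i
    proof (cases "\<bar>i\<bar> > N")
      case False
      then have "i = N \<or> i = - N" using that by (auto simp: N_def)
      then show ?thesis using \<pi>(4) signed_permsD(2)[OF even_perms_signed[OF \<pi>(1)], of N] by auto
    qed (rule \<pi>(2))
  qed (use Suc.prems \<pi> in auto)
  \<comment> \<open>Composing with the same reflection again recovers \<pi>, so membership can be
    tested after any available reflection.\<close>
  have reduce: "\<pi> \<in> S"
    if \<sigma>: "signed_swap i j \<in> S" "signed_swap i j \<circ> \<pi> \<in> S" "i \<in> signed" "j \<in> signed" "i \<noteq> - j"
    for \<pi> i j
  proof -
    have "signed_swap i j \<circ> (signed_swap i j \<circ> \<pi>) = \<pi>"
      using signed_swap_involution[OF \<sigma>(3-5)] by (simp add: fun_eq_iff)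
    then show ?thesis using comp[OF \<sigma>(2,1)] by (simp only:)
  qed
  have swap: "signed_swap k (k + 1) \<in> S" "signed_swap k (k + 1) \<in> even_perms"
    "signed_swap k (k + 1) ` positives = positives" "k \<in> signed" "k + 1 \<in> signed"
    if "1 \<le> k" "k < N" for k
    using that Suc.prems(2)[of k] N signed_swap_even_perms[of k "k + 1"] signed_swap_positives[of k "k + 1"]
    by (auto simp: N_def positives_def signed_def)
  \<comment> \<open>Induction on the distance m of \<open>\<pi> N\<close> from N; each reflection
    raises the image by one.\<close>
  have up: "\<pi> \<in> S"
    if "\<pi> \<in> even_perms" "\<And>i. \<bar>i\<bar> > N \<Longrightarrow> \<pi> i = i"
      "signed_swap 1 (- 2) \<in> S \<or> \<pi> ` positives = positives" "\<pi> N = N - int m" "int m < N" for \<pi> m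
    using that
  proof (induction m arbitrary: \<pi>)
    case 0
    then show ?case by (intro step) auto
  next
    case (Suc m)
    define k where "k = N - int (Suc m)"
    have k: "1 \<le> k" "k < N" using Suc.prems by (auto simp: k_def)
    have "signed_swap k (k + 1) \<circ> \<pi> \<in> S"
    proof (rule Suc.IH)
      show "signed_swap k (k + 1) \<circ> \<pi> \<in> even_perms"
        using even_perms_comp[OF Suc.prems(1) swap(2)[OF k]] .
      show "(signed_swap k (k + 1) \<circ> \<pi>) i = i" if "\<bar>i\<bar> > N" for i
        using that k Suc.prems(2)[OF that] by (auto simp: signed_swap_def)
      show "signed_swap 1 (- 2) \<in> S \<or> (signed_swap k (k + 1) \<circ> \<pi>) ` positives = positives"
        using Suc.prems(3) swap(3)[OF k] by (metis image_comp)
      show "(signed_swap k (k + 1) \<circ> \<pi>) N = N - int m"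
        using Suc.prems(4) by (simp add: signed_swap_def k_def)
    qed (use Suc.prems(5) in simp)
    then show ?case using reduce[OF swap(1)] swap(4,5) k by auto
  qed
  \<comment> \<open>A negative image is raised to -1 in the same way, with m the distance still to
    go.\<close>
  have down: "\<pi> \<in> S"
    if "\<pi> \<in> even_perms" "\<And>i. \<bar>i\<bar> > N \<Longrightarrow> \<pi> i = i"
      "signed_swap 1 (- 2) \<in> S" "\<pi> N = - 1 - int m" "1 + int m \<le> N" for \<pi> m
    using that
  proof (induction m arbitrary: \<pi>)
    case 0
    have "signed_swap 1 (- 2) \<circ> \<pi> \<in> S"
    \<comment> \<open>\<open>signed_swap 1 (- 2)\<close> sends -1 to 2, whose distance to N is
      \<open>N - 2\<close>.\<close>
    proof (rule up[where m = "nat (N - 2)"])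
      show "signed_swap 1 (- 2) \<circ> \<pi> \<in> even_perms"
        using even_perms_comp[OF 0(1) signed_swap_neg_even_perms] .
      show "(signed_swap 1 (- 2) \<circ> \<pi>) i = i" if "\<bar>i\<bar> > N" for i
        using that N 0(2)[OF that] by (auto simp: signed_swap_def)
      show "(signed_swap 1 (- 2) \<circ> \<pi>) N = N - int (nat (N - 2))"
        using 0(4) N by (simp add: signed_swap_def)
    qed (use 0 N in auto)
    then show ?case using reduce[OF 0(3)] by (auto simp: signed_def)
  next
    case (Suc m)
    define k where "k = 1 + int m"
    have k: "1 \<le> k" "k < N" using Suc.prems by (auto simp: k_def)
    have "signed_swap k (k + 1) \<circ> \<pi> \<in> S"
    proof (rule Suc.IH)
      show "signed_swap k (k + 1) \<circ> \<pi> \<in> even_perms"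
        using even_perms_comp[OF Suc.prems(1) swap(2)[OF k]] .
      show "(signed_swap k (k + 1) \<circ> \<pi>) i = i" if "\<bar>i\<bar> > N" for i
        using that k Suc.prems(2)[OF that] by (auto simp: signed_swap_def)
      show "(signed_swap k (k + 1) \<circ> \<pi>) N = - 1 - int m"
        using Suc.prems(4) by (simp add: signed_swap_def k_def)
    qed (use Suc.prems in auto)
    then show ?case using reduce[OF swap(1)] swap(4,5) k by auto
  qed
  note s = even_perms_signed[OF Suc.prems(3)]
  have fix': "\<And>i. \<bar>i\<bar> > N \<Longrightarrow> \<pi> i = i" using Suc.prems(4) by (simp add: N_def)
  have "\<pi> N \<in> signed" using signed_permsD(5)[OF s] N by (simp add: signed_def)
  have "\<bar>\<pi> N\<bar> \<le> N"
  proof (rule ccontr)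
    assume *: "\<not> \<bar>\<pi> N\<bar> \<le> N"
    then have "\<pi> (\<pi> N) = \<pi> N" using fix' by simp
    then have "\<pi> N = N" using signed_permsD(3)[OF s] by (simp add: inj_eq)
    then show False using * N by simp
  qed
  show ?case
  proof (cases "\<pi> N > 0")
    case True
    then show ?thesis
      using up[OF Suc.prems(3) fix' Suc.prems(5), of "nat (N - \<pi> N)"] \<open>\<bar>\<pi> N\<bar> \<le> N\<close> by simp
  next
    case False
    then have "\<pi> N < 0" using \<open>\<pi> N \<in> signed\<close> by (simp add: signed_def)
    then have "\<pi> N \<notin> positives" "N \<in> positives"
      using N by (simp_all add: positives_def)
    \<comment> \<open>This excludes the second alternative of the sign hypothesis, so
      \<open>signed_swap 1 (- 2)\<close> is available.\<close>
    then have "\<pi> ` positives \<noteq> positives" by blast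
    then show ?thesis
      using down[OF Suc.prems(3) fix', of "nat (- 1 - \<pi> N)"] Suc.prems(5) \<open>\<bar>\<pi> N\<bar> \<le> N\<close> \<open>\<pi> N < 0\<close>
      by simp
  qed
qed

section \<open>The group \<open>M\<close> as a group of signed permutations\<close>

text \<open>
  Up to the fixed \<open>level\<close>, \<open>M\<close> is the Weyl group of type $D_6$: for the functionals \<open>weight 1\<close>, \dots,
  \<open>weight 6\<close> the involutions $(34), (23), A_0(34), (67), (56)$ are the adjacent transpositions and
  $(12)$ exchanges \<open>weight 1\<close> with \<open>- weight 2\<close>. Negative indices denote negated functionals.
\<close>

definition weight :: "int \<Rightarrow> complex^7 \<Rightarrow> complex"
  where "weight i x = of_int (sgn i) *
    [x$2 + x$3 - x$1 - x$4, x$2 + x$4 - x$1 - x$3, x$3 + x$4 - x$1 - x$2,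
     2 * x$7 - x$1 - x$2 - x$3 - x$4, 2 * x$6 - x$1 - x$2 - x$3 - x$4,
     2 * x$5 - x$1 - x$2 - x$3 - x$4] ! nat (\<bar>i\<bar> - 1)"

definition level :: "complex^7 \<Rightarrow> complex"
  where "level x = x$5 + x$6 + x$7 - x$1 - x$2 - x$3 - x$4"

text \<open>The inverse of the coordinate change: the sum of the weights and the level yield a,
  \<open>weight 1 + weight 2\<close> is twice b - a, similarly for c and d, and s is a + b + c +
  d.\<close>

definition from_weights :: "(int \<Rightarrow> complex) \<Rightarrow> complex \<Rightarrow> complex^7"
  where "from_weights y t =
    (let a = (2 * t - (y 1 + y 2 + y 3 + y 4 + y 5 + y 6)) / 4;
         s = 4 * a + y 1 + y 2 + y 3
     in vector [a, a + (y 1 + y 2) / 2, a + (y 1 + y 3) / 2, a + (y 2 + y 3) / 2,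
          (y 6 + s) / 2, (y 5 + s) / 2, (y 4 + s) / 2])"

definition weight_matrix :: "(int \<Rightarrow> int) \<Rightarrow> complex^7^7"
  where "weight_matrix \<pi> = matrix (\<lambda>x. from_weights (\<lambda>i. weight (\<pi> i) x) (level x))"

lemma weight_uminus: "weight (- i) x = - weight i x"
  by (simp add: weight_def sgn_minus)

text \<open>Beyond 6 in absolute value the list is indexed past its end, hence the restriction to
  letters.\<close>

lemma weight_linear:
  "weight i (x + y) = weight i x + weight i y" "weight i (c *s x) = c * weight i x" if "i \<in> signed"
  using that by (auto simp: signed_eq weight_def algebra_simps)

lemma level_linear: "level (x + y) = level x + level y" "level (c *s x) = c * level x"
  by (simp_all add: level_def algebra_simps)

lemma weight_from_weights: "i \<in> positives \<Longrightarrow> weight i (from_weights y t) = y i"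
  by (auto simp: positives_eq weight_def from_weights_def Let_def field_simps)

lemma level_from_weights: "level (from_weights y t) = t"
  by (simp add: level_def from_weights_def Let_def field_simps)

lemma from_weights_weight: "from_weights (\<lambda>i. weight i x) (level x) = x"
  by (simp add: vec_eq_iff forall_7 from_weights_def Let_def weight_def level_def field_simps)

lemma from_weights_cong: "(\<And>i. i \<in> positives \<Longrightarrow> y i = z i) \<Longrightarrow> from_weights y t = from_weights z t"
  by (simp add: from_weights_def positives_eq)

lemma weights_eqI:
  assumes "\<And>i. i \<in> positives \<Longrightarrow> weight i x = weight i y" "level x = level y"
  shows "x = y"
proof -
  have "from_weights (\<lambda>i. weight i x) (level x) = from_weights (\<lambda>i. weight i y) (level y)"
    unfolding assms(2) by (rule from_weights_cong) (rule assms(1))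
  then show ?thesis by (simp only: from_weights_weight)
qed

section \<open>Matrices of signed permutations\<close>

lemma weight_matrix_mult:
  assumes "\<pi> \<in> signed_perms"
  shows "weight_matrix \<pi> *v x = from_weights (\<lambda>i. weight (\<pi> i) x) (level x)"
proof -
  have "\<pi> i \<in> signed" if "i \<in> positives" for i
    using signed_permsD(5)[OF assms] that by (simp add: positives_def signed_def)
  then have "weight (\<pi> i) (x + y) = weight (\<pi> i) x + weight (\<pi> i) y"
    "weight (\<pi> i) (c *s x) = c * weight (\<pi> i) x" if "i \<in> {1, 2, 3, 4, 5, 6}" for i c x y
    using that by (simp_all add: weight_linear positives_eq)
  then have "Vector_Spaces.linear (*s) (*s) (\<lambda>x. from_weights (\<lambda>i. weight (\<pi> i) x) (level x))"
    by unfold_locales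
      (simp_all add: vec_eq_iff forall_7 from_weights_def Let_def level_linear field_simps)
  then show ?thesis
    unfolding weight_matrix_def by (rule matrix_works)
qed

lemma
  assumes "\<pi> \<in> signed_perms"
  shows weight_mult: "i \<in> signed \<Longrightarrow> weight i (weight_matrix \<pi> *v x) = weight (\<pi> i) x"
    and level_mult: "level (weight_matrix \<pi> *v x) = level x"
proof -
  have pos: "weight i (weight_matrix \<pi> *v x) = weight (\<pi> i) x" if "i \<in> positives" for i
    using that by (simp add: weight_matrix_mult[OF assms] weight_from_weights)
  show "weight i (weight_matrix \<pi> *v x) = weight (\<pi> i) x" if "i \<in> signed"
  proof (cases "i \<in> positives")
    case False
    then have "- i \<in> positives" using that by (auto simp: signed_eq positives_eq)
    from pos[OF this] show ?thesis
      by (simp add: weight_uminus signed_permsD(2)[OF assms])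
  qed (rule pos)
  show "level (weight_matrix \<pi> *v x) = level x"
    by (simp add: weight_matrix_mult[OF assms] level_from_weights)
qed

text \<open>A matrix is determined by its action on V, and a point by its weights and level; on V
  the level is preserved exactly if it stays 1.\<close>

lemma weight_matrix_eqI:
  assumes "\<pi> \<in> signed_perms" "\<And>i x. x \<in> V \<Longrightarrow> i \<in> positives \<Longrightarrow> weight i (A *v x) = weight (\<pi> i) x"
    "\<And>x. x \<in> V \<Longrightarrow> level (A *v x) = 1"
  shows "A = weight_matrix \<pi>"
proof (rule matrix_determined_on_V, rule ballI, rule weights_eqI)
  fix x i assume x: "x \<in> V"
  show "weight i (A *v x) = weight i (weight_matrix \<pi> *v x)" if "i \<in> positives"
    using that x assms by (simp add: weight_mult positives_def signed_def)
  show "level (A *v x) = level (weight_matrix \<pi> *v x)"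
    using x assms by (simp add: level_mult) (simp add: V_def level_def)
qed

lemma level_V: "x \<in> V \<longleftrightarrow> level x = 1"
  by (simp add: V_def level_def)

lemma weight_matrix_id: "weight_matrix id = mat 1"
  by (rule weight_matrix_eqI[symmetric]) (simp_all add: even_perms_signed even_perms_id level_V)

text \<open>Weights are read off after the matrices have acted, so \<open>weight i\<close> becomes
  first \<open>weight (\<pi> i)\<close> and then \<open>weight (\<sigma> (\<pi> i))\<close>; the
  order is reversed.\<close>

lemma weight_matrix_comp:
  assumes "\<pi> \<in> signed_perms" "\<sigma> \<in> signed_perms"
  shows "weight_matrix \<pi> ** weight_matrix \<sigma> = weight_matrix (\<sigma> \<circ> \<pi>)"
proof (rule weight_matrix_eqI)
  show "weight i ((weight_matrix \<pi> ** weight_matrix \<sigma>) *v x) = weight ((\<sigma> \<circ> \<pi>) i) x"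
    if "i \<in> positives" for i x
    using that assms signed_permsD(5)[OF assms(1), of i]
    by (simp add: matrix_vector_mul_assoc[symmetric] weight_mult positives_def signed_def)
  show "level ((weight_matrix \<pi> ** weight_matrix \<sigma>) *v x) = 1" if "x \<in> V" for x
    using that assms by (simp add: matrix_vector_mul_assoc[symmetric] level_mult level_V)
qed (rule signed_perms_comp[OF assms])

lemma weight_matrix_inj:
  assumes "\<pi> \<in> signed_perms" "\<sigma> \<in> signed_perms" "weight_matrix \<pi> = weight_matrix \<sigma>"
  shows "\<pi> = \<sigma>"
proof
  \<comment> \<open>At this point every letter i has weight i, so the weights tell all twelve
    letters apart.\<close>
  define u where "u = from_weights of_int 0"
  have pos: "weight i u = of_int i" if "i \<in> positives" for i
    using that by (simp add: u_def weight_from_weights)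
  have u: "weight i u = of_int i" if "i \<in> signed" for i
  proof (cases "i \<in> positives")
    case False
    then have "- i \<in> positives" using that by (auto simp: signed_eq positives_eq)
    from pos[OF this] show ?thesis by (simp add: weight_uminus)
  qed (rule pos)
  fix i show "\<pi> i = \<sigma> i"
  proof (cases "i \<in> signed")
    case True
    have "weight (\<pi> i) u = weight i (weight_matrix \<pi> *v u)"
      using weight_mult[OF assms(1) True] by simp
    also have "\<dots> = weight (\<sigma> i) u"
      unfolding assms(3) using weight_mult[OF assms(2) True] .
    finally show ?thesis
      using True u signed_permsD(5)[OF assms(1)] signed_permsD(5)[OF assms(2)] by simp
  next
    case False
    then show ?thesis
      using permutes_not_in[OF signed_permsD(1)[OF assms(1)]]
        permutes_not_in[OF signed_permsD(1)[OF assms(2)]] by simp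
  qed
qed

section \<open>Generators of the three groups\<close>

lemma group_GL7: "group GL7"
proof (rule groupI)
  fix A assume "A \<in> carrier GL7"
  then show "\<exists>B\<in>carrier GL7. B \<otimes>\<^bsub>GL7\<^esub> A = \<one>\<^bsub>GL7\<^esub>"
    by (auto simp: GL7_def invertible_def)
qed (auto simp: GL7_def invertible_mult matrix_mul_assoc invertible_def[of "mat 1"]
  intro!: exI[of _ "mat 1"])

lemma weight_matrix_GL7:
  assumes "\<pi> \<in> signed_perms"
  shows "weight_matrix \<pi> \<in> carrier GL7"
proof -
  have "\<pi> \<circ> inv_into UNIV \<pi> = id" "inv_into UNIV \<pi> \<circ> \<pi> = id"
    using permutes_inv_o[OF signed_permsD(1)[OF assms]] by simp_all
  then have "weight_matrix \<pi> ** weight_matrix (inv_into UNIV \<pi>) = mat 1"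
    "weight_matrix (inv_into UNIV \<pi>) ** weight_matrix \<pi> = mat 1"
    using assms by (simp_all add: weight_matrix_comp signed_perms_inv weight_matrix_id)
  then show ?thesis by (auto simp: GL7_def invertible_def)
qed

text \<open>Exchanging a and b turns b + c - a - d into the negative of b + d - a - c; the other
  four generators permute the weights without signs.\<close>

lemma weight_matrix_perm_mat:
  "swap_mat 1 2 = weight_matrix (signed_swap 1 (- 2))"
  "swap_mat 2 3 = weight_matrix (signed_swap 2 3)"
  "swap_mat 3 4 = weight_matrix (signed_swap 1 2)"
  "swap_mat 5 6 = weight_matrix (signed_swap 5 6)"
  "swap_mat 6 7 = weight_matrix (signed_swap 4 5)"
proof -
  have swap: "(swap_mat i j *v x) $ k = x $ Transposition.transpose i j k" for i j k x
  proof -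
    have "k = Transposition.transpose i j l \<longleftrightarrow> l = Transposition.transpose i j k" for l
      by (metis Transposition.transpose_involutory)
    then have "(swap_mat i j *v x) $ k =
      (\<Sum>l\<in>UNIV. (if l = Transposition.transpose i j k then 1 else 0) * x $ l)"
      by (simp add: perm_mat_def matrix_vector_mult_def)
    then show ?thesis by (simp add: if_distrib[of "\<lambda>c. c * _"] cong: if_cong)
  qed
  note [simp] = level_V level_def weight_def swap Transposition.transpose_def signed_swap_def
  have s: "signed_swap i j \<in> signed_perms" if "i \<in> positives" "j \<in> positives \<or> i = 1 \<and> j = - 2" for i j
    using signed_swap_even_perms signed_swap_neg_even_perms even_perms_signed that by blast
  show "swap_mat 1 2 = weight_matrix (signed_swap 1 (- 2))"
    "swap_mat 2 3 = weight_matrix (signed_swap 2 3)"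
    "swap_mat 3 4 = weight_matrix (signed_swap 1 2)"
    "swap_mat 5 6 = weight_matrix (signed_swap 5 6)"
    "swap_mat 6 7 = weight_matrix (signed_swap 4 5)"
    by (rule weight_matrix_eqI; auto intro!: s simp: positives_eq algebra_simps)+
qed

text \<open>This is the only generator that links the weights in a, b, c, d alone with those
  involving e, f, g.\<close>

lemma weight_matrix_A0: "A\<^sub>0 = weight_matrix (signed_swap 1 2 \<circ> signed_swap 3 4)"
proof (rule weight_matrix_eqI)
  show "signed_swap 1 2 \<circ> signed_swap 3 4 \<in> signed_perms"
    by (intro signed_perms_comp even_perms_signed signed_swap_even_perms) (auto simp: positives_eq)
qed (auto simp: A\<^sub>0_mult coord_map_def level_V level_def weight_def signed_swap_def positives_eq algebra_simps)

text \<open>Upper bound for a generated group: the generators are involutions, so closure under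
  products already accounts for inverses.\<close>

lemma weight_matrix_generate_subset:
  assumes H: "\<Sigma> \<subseteq> H" "H \<subseteq> even_perms" "id \<in> H" "\<And>\<pi> \<sigma>. \<pi> \<in> H \<Longrightarrow> \<sigma> \<in> H \<Longrightarrow> \<sigma> \<circ> \<pi> \<in> H"
    and inv: "\<And>\<sigma>. \<sigma> \<in> \<Sigma> \<Longrightarrow> \<sigma> \<circ> \<sigma> = id"
  shows "generate GL7 (weight_matrix ` \<Sigma>) \<subseteq> weight_matrix ` H"
proof
  interpret group GL7 by (rule group_GL7)
  have H': "\<pi> \<in> signed_perms" if "\<pi> \<in> H" for \<pi>
    using H(2) that even_perms_signed by blast
  fix A assume "A \<in> generate GL7 (weight_matrix ` \<Sigma>)"
  then show "A \<in> weight_matrix ` H"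
  proof (induction rule: generate.induct)
    case one
    have "\<one>\<^bsub>GL7\<^esub> = weight_matrix id" by (simp add: weight_matrix_id GL7_def)
    then show ?case using H(3) by blast
  next
    case (incl A)
    then show ?case using H(1) by blast
  next
    case (inv A)
    then obtain \<sigma> where \<sigma>: "\<sigma> \<in> \<Sigma>" "A = weight_matrix \<sigma>" by blast
    then have s: "\<sigma> \<in> signed_perms" using H(1) H' by blast
    have "A \<otimes>\<^bsub>GL7\<^esub> A = \<one>\<^bsub>GL7\<^esub>"
      using \<sigma>(2) weight_matrix_comp[OF s s] assms(5)[OF \<sigma>(1)] by (simp add: GL7_def weight_matrix_id)
    then have "inv\<^bsub>GL7\<^esub> A = A"
      using weight_matrix_GL7[OF s] \<sigma>(2) inv_equality by simp
    then show ?case using \<sigma> H(1) by auto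
  next
    case (eng A B)
    then obtain \<pi> \<sigma> where "\<pi> \<in> H" "\<sigma> \<in> H" "A = weight_matrix \<pi>" "B = weight_matrix \<sigma>"
      by blast
    then have "A \<otimes>\<^bsub>GL7\<^esub> B = weight_matrix (\<sigma> \<circ> \<pi>)" "\<sigma> \<circ> \<pi> \<in> H"
      using weight_matrix_comp H' H(4) by (simp_all add: GL7_def)
    then show ?case by blast
  qed
qed

text \<open>Lower bound shared by the three groups: n = 6 for \<open>M\<close> and
  \<open>G\<^sub>K\<close>, n = 5 for \<open>G\<^sub>L\<close>, with a sign-changing generator or
  invariance of the positive letters according to the group.\<close>

lemma weight_matrix_generate_supset:
  fixes n :: nat
  assumes \<Sigma>: "\<Sigma> \<subseteq> even_perms"
    and swap: "\<And>k. 1 \<le> k \<Longrightarrow> k < int n \<Longrightarrow> k \<noteq> 3 \<Longrightarrow> signed_swap k (k + 1) \<in> \<Sigma>"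
      "signed_swap 1 2 \<in> \<Sigma>" "signed_swap 1 2 \<circ> signed_swap 3 4 \<in> \<Sigma>"
    and n: "1 \<le> n" "n \<le> 6"
    and \<pi>: "\<pi> \<in> even_perms" "\<And>i. \<bar>i\<bar> > int n \<Longrightarrow> \<pi> i = i"
    and neg: "signed_swap 1 (- 2) \<in> \<Sigma> \<or> \<pi> ` positives = positives"
  shows "weight_matrix \<pi> \<in> generate GL7 (weight_matrix ` \<Sigma>)"
proof -
  define S where "S = {\<pi> \<in> even_perms. weight_matrix \<pi> \<in> generate GL7 (weight_matrix ` \<Sigma>)}"
  have incl: "\<sigma> \<in> S" if "\<sigma> \<in> \<Sigma>" for \<sigma>
    using that \<Sigma> by (auto simp: S_def intro: generate.incl)
  have comp: "\<sigma> \<circ> \<pi> \<in> S" if "\<pi> \<in> S" "\<sigma> \<in> S" for \<pi> \<sigma>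
  proof -
    have "weight_matrix (\<sigma> \<circ> \<pi>) = weight_matrix \<pi> \<otimes>\<^bsub>GL7\<^esub> weight_matrix \<sigma>"
      using that by (simp add: S_def GL7_def weight_matrix_comp even_perms_signed)
    then show ?thesis
      using that by (simp add: S_def even_perms_comp generate.eng)
  qed
  have "\<pi> \<in> S"
  proof (rule even_perms_generated[OF _ comp _ n \<pi>])
    have "\<one>\<^bsub>GL7\<^esub> = weight_matrix id" by (simp add: weight_matrix_id GL7_def)
    then show "id \<in> S"
      using generate.one[of GL7 "weight_matrix ` \<Sigma>"] by (simp only: S_def mem_Collect_eq even_perms_id)
    show "signed_swap k (k + 1) \<in> S" if k: "1 \<le> k" "k < int n" for k
    proof (cases "k = 3")
      case True
      have "signed_swap 1 2 (signed_swap 1 2 i) = i" for i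
        by (rule signed_swap_involution) (auto simp: signed_def)
      \<comment> \<open>\<open>A\<^sub>0\<close> contributes this adjacent swap, once its factor
        \<open>signed_swap 1 2\<close> has been cancelled.\<close>
      then have "signed_swap 3 4 = signed_swap 1 2 \<circ> (signed_swap 1 2 \<circ> signed_swap 3 4)"
        by (simp add: fun_eq_iff)
      then show ?thesis
        using comp[OF incl[OF swap(3)] incl[OF swap(2)]] True by simp
    qed (use incl swap(1) k in blast)
    show "signed_swap 1 (- 2) \<in> S \<or> \<pi> ` positives = positives"
      using neg incl by blast
  qed
  then show ?thesis by (simp add: S_def)
qed

lemma generators_even:
  "{signed_swap 1 (- 2), signed_swap 2 3, signed_swap 1 2, signed_swap 5 6, signed_swap 4 5,
    signed_swap 1 2 \<circ> signed_swap 3 4} \<subseteq> even_perms"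
  by (auto intro!: even_perms_comp signed_swap_even_perms signed_swap_neg_even_perms simp: positives_eq)

lemma generators_involution:
  assumes "\<sigma> \<in> {signed_swap 1 (- 2), signed_swap 2 3, signed_swap 1 2, signed_swap 5 6, signed_swap 4 5,
    signed_swap 1 2 \<circ> signed_swap 3 4}"
  shows "\<sigma> \<circ> \<sigma> = id"
proof
  fix k
  have "signed_swap i j (signed_swap i j k) = k"
    if "(i, j) \<in> {(1, - 2), (2, 3), (1, 2), (5, 6), (4, 5)}" for i j
    using that by (intro signed_swap_involution) (auto simp: signed_def)
  moreover have "signed_swap 1 2 (signed_swap 3 4 (signed_swap 1 2 (signed_swap 3 4 k))) = k"
    by (simp add: signed_swap_def)
  ultimately show "(\<sigma> \<circ> \<sigma>) k = id k" using assms by auto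
qed

lemma M_set_eq: "M_set = weight_matrix ` even_perms"
proof -
  let ?\<Sigma> = "{signed_swap 1 (- 2), signed_swap 2 3, signed_swap 1 2, signed_swap 5 6, signed_swap 4 5,
    signed_swap 1 2 \<circ> signed_swap 3 4}"
  have eq: "M_set = generate GL7 (weight_matrix ` ?\<Sigma>)"
    unfolding M_set_def weight_matrix_perm_mat weight_matrix_A0 by simp
  have "weight_matrix \<pi> \<in> M_set" if "\<pi> \<in> even_perms" for \<pi>
    unfolding eq
  proof (rule weight_matrix_generate_supset[where n = 6])
    show "signed_swap k (k + 1) \<in> ?\<Sigma>" if "1 \<le> k" "k < int 6" "k \<noteq> 3" for k
    proof -
      have "k \<in> {1, 2, 4, 5}" using that by auto
      then show ?thesis by auto
    qed
    show "\<pi> i = i" if "\<bar>i\<bar> > int 6" for i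
      using permutes_not_in[OF signed_permsD(1)[OF even_perms_signed[OF \<open>\<pi> \<in> even_perms\<close>]]] that
      by (simp add: signed_def)
  qed (use that generators_even in auto)
  moreover have "M_set \<subseteq> weight_matrix ` even_perms"
    unfolding eq
    by (rule weight_matrix_generate_subset)
      (use generators_even generators_involution even_perms_id even_perms_comp in \<open>auto simp del: id_apply\<close>)
  ultimately show ?thesis by blast
qed

text \<open>Without (12) no generator changes a sign, which leaves the symmetric group on the six
  positive letters, of order 720.\<close>

lemma G\<^sub>K_eq: "G\<^sub>K = weight_matrix ` {\<pi> \<in> even_perms. \<pi> ` positives = positives}"
proof -
  let ?\<Sigma> = "{signed_swap 2 3, signed_swap 1 2, signed_swap 5 6, signed_swap 4 5,
    signed_swap 1 2 \<circ> signed_swap 3 4}"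
  have eq: "G\<^sub>K = generate GL7 (weight_matrix ` ?\<Sigma>)"
    unfolding G\<^sub>K_def weight_matrix_perm_mat weight_matrix_A0 by simp
  have "weight_matrix \<pi> \<in> G\<^sub>K" if "\<pi> \<in> even_perms" "\<pi> ` positives = positives" for \<pi>
    unfolding eq
  proof (rule weight_matrix_generate_supset[where n = 6])
    show "signed_swap k (k + 1) \<in> ?\<Sigma>" if "1 \<le> k" "k < int 6" "k \<noteq> 3" for k
    proof -
      have "k \<in> {1, 2, 4, 5}" using that by auto
      then show ?thesis by auto
    qed
    show "\<pi> i = i" if "\<bar>i\<bar> > int 6" for i
      using permutes_not_in[OF signed_permsD(1)[OF even_perms_signed[OF \<open>\<pi> \<in> even_perms\<close>]]] that
      by (simp add: signed_def)
  qed (use that generators_even in auto)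
  moreover have "G\<^sub>K \<subseteq> weight_matrix ` {\<pi> \<in> even_perms. \<pi> ` positives = positives}"
    unfolding eq
  proof (rule weight_matrix_generate_subset)
    have sw: "signed_swap i j ` positives = positives" if "i \<in> {1..6}" "j \<in> {1..6}" for i j
      using that signed_swap_positives by (simp add: positives_def)
    have comp: "(\<sigma> \<circ> \<pi>) ` positives = positives"
      if "\<pi> ` positives = positives" "\<sigma> ` positives = positives" for \<pi> \<sigma> :: "int \<Rightarrow> int"
      using that by (metis image_comp)
    show "?\<Sigma> \<subseteq> {\<pi> \<in> even_perms. \<pi> ` positives = positives}"
      using generators_even sw comp by simp
    show "\<sigma> \<circ> \<pi> \<in> {\<pi> \<in> even_perms. \<pi> ` positives = positives}"
      if "\<pi> \<in> {\<pi> \<in> even_perms. \<pi> ` positives = positives}"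
        "\<sigma> \<in> {\<pi> \<in> even_perms. \<pi> ` positives = positives}" for \<pi> \<sigma>
      using that comp[of \<pi> \<sigma>] even_perms_comp[of \<pi> \<sigma>] by (simp only: mem_Collect_eq)
    show "\<sigma> \<circ> \<sigma> = id" if "\<sigma> \<in> ?\<Sigma>" for \<sigma>
      using that generators_involution by blast
  qed (use even_perms_id in auto)
  ultimately show ?thesis by blast
qed

text \<open>Without (56) the reflections generate the group of type $D_5$ on the letters 1 to 5, of
  order 16 * 120 = 1920.\<close>

lemma G\<^sub>L_eq: "G\<^sub>L = weight_matrix ` {\<pi> \<in> even_perms. \<pi> 6 = 6}"
proof -
  let ?\<Sigma> = "{signed_swap 1 (- 2), signed_swap 2 3, signed_swap 1 2, signed_swap 4 5,
    signed_swap 1 2 \<circ> signed_swap 3 4}"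
  have eq: "G\<^sub>L = generate GL7 (weight_matrix ` ?\<Sigma>)"
    unfolding G\<^sub>L_def weight_matrix_perm_mat weight_matrix_A0 by simp
  have "weight_matrix \<pi> \<in> G\<^sub>L" if \<pi>: "\<pi> \<in> even_perms" "\<pi> 6 = 6" for \<pi>
    unfolding eq
  proof (rule weight_matrix_generate_supset[where n = 5])
    show "signed_swap k (k + 1) \<in> ?\<Sigma>" if "1 \<le> k" "k < int 5" "k \<noteq> 3" for k
    proof -
      have "k \<in> {1, 2, 4}" using that by auto
      then show ?thesis by auto
    qed
    show "\<pi> i = i" if "\<bar>i\<bar> > int 5" for i
    proof (cases "i \<in> signed")
      case True
      then have "i = 6 \<or> i = - 6" using that by (auto simp: signed_def)
      then show ?thesis
        using \<pi>(2) signed_permsD(2)[OF even_perms_signed[OF \<pi>(1)], of 6] by auto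
    next
      case False
      then show ?thesis
        using permutes_not_in[OF signed_permsD(1)[OF even_perms_signed[OF \<pi>(1)]]] by simp
    qed
  qed (use that generators_even in auto)
  moreover have "G\<^sub>L \<subseteq> weight_matrix ` {\<pi> \<in> even_perms. \<pi> 6 = 6}"
    unfolding eq
  proof (rule weight_matrix_generate_subset)
    show "?\<Sigma> \<subseteq> {\<pi> \<in> even_perms. \<pi> 6 = 6}"
      using generators_even by (simp add: signed_swap_def)
    show "\<sigma> \<circ> \<pi> \<in> {\<pi> \<in> even_perms. \<pi> 6 = 6}"
      if "\<pi> \<in> {\<pi> \<in> even_perms. \<pi> 6 = 6}" "\<sigma> \<in> {\<pi> \<in> even_perms. \<pi> 6 = 6}" for \<pi> \<sigma>
      using that even_perms_comp by simp
    show "\<sigma> \<circ> \<sigma> = id" if "\<sigma> \<in> ?\<Sigma>" for \<sigma>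
      using that generators_involution by blast
  qed (use even_perms_id in auto)
  ultimately show ?thesis by blast
qed

text \<open>
  The stabilizer of the set of positive indices is \<open>G\<^sub>K\<close> and that of the index 6 is \<open>G\<^sub>L\<close>, so that
  cosets are recorded by the image of this set and of this index, respectively.
\<close>

definition transversal_coset :: "int set \<Rightarrow> (complex^7^7) set"
  where "transversal_coset T = weight_matrix ` {\<pi> \<in> even_perms. \<pi> ` positives = T}"

definition index_coset :: "int \<Rightarrow> (complex^7^7) set"
  where "index_coset i = weight_matrix ` {\<pi> \<in> even_perms. \<pi> 6 = i}"

section \<open>Right multiplication of cosets\<close>

lemma carrier_M: "carrier M = weight_matrix ` even_perms"
  by (simp add: M_def M_set_eq)

lemma weight_matrix_r_coset:
  assumes "P \<subseteq> even_perms" "\<pi> \<in> even_perms"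
  shows "weight_matrix ` P #>\<^bsub>M\<^esub> weight_matrix \<pi> = weight_matrix ` ((\<circ>) \<pi> ` P)"
proof -
  have "weight_matrix \<sigma> ** weight_matrix \<pi> = weight_matrix (\<pi> \<circ> \<sigma>)" if "\<sigma> \<in> P" for \<sigma>
    using that assms by (intro weight_matrix_comp) (auto intro: even_perms_signed)
  then show ?thesis
    by (auto simp: r_coset_def M_def GL7_def)
qed

text \<open>Composition with \<pi> is a bijection of the group, a preimage of \<sigma> being
  obtained from the inverse of \<pi>. Both kinds of cosets are moved this way.\<close>

lemma even_perms_translate:
  assumes "\<pi> \<in> even_perms" "\<And>\<sigma>. Q (\<pi> \<circ> \<sigma>) \<longleftrightarrow> P \<sigma>"
  shows "(\<circ>) \<pi> ` {\<sigma> \<in> even_perms. P \<sigma>} = {\<sigma> \<in> even_perms. Q \<sigma>}"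
proof (intro Set.set_eqI iffI)
  fix \<sigma> assume "\<sigma> \<in> (\<circ>) \<pi> ` {\<sigma> \<in> even_perms. P \<sigma>}"
  then show "\<sigma> \<in> {\<sigma> \<in> even_perms. Q \<sigma>}"
    using assms even_perms_comp by blast
next
  fix \<sigma> assume \<sigma>: "\<sigma> \<in> {\<sigma> \<in> even_perms. Q \<sigma>}"
  define \<tau> where "\<tau> = inv_into UNIV \<pi> \<circ> \<sigma>"
  have "\<pi> \<circ> inv_into UNIV \<pi> = id"
    using permutes_inv_o(1)[OF signed_permsD(1)[OF even_perms_signed[OF assms(1)]]] .
  then have "\<pi> \<circ> \<tau> = \<sigma>" unfolding \<tau>_def by (metis comp_assoc id_comp)
  moreover have "\<tau> \<in> even_perms"
    using \<sigma> assms(1) by (simp add: \<tau>_def even_perms_comp even_perms_inv)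
  ultimately show "\<sigma> \<in> (\<circ>) \<pi> ` {\<sigma> \<in> even_perms. P \<sigma>}"
    using \<sigma> assms(2)[of \<tau>] by auto
qed

lemma transversal_coset_mult:
  assumes "\<pi> \<in> even_perms"
  shows "transversal_coset T #>\<^bsub>M\<^esub> weight_matrix \<pi> = transversal_coset (\<pi> ` T)"
proof -
  have "(\<pi> \<circ> \<sigma>) ` positives = \<pi> ` T \<longleftrightarrow> \<sigma> ` positives = T" for \<sigma>
    using inj_image_eq_iff[OF signed_permsD(3)[OF even_perms_signed[OF assms]]] by (metis image_comp)
  then have eq: "(\<circ>) \<pi> ` {\<sigma> \<in> even_perms. \<sigma> ` positives = T} = {\<sigma> \<in> even_perms. \<sigma> ` positives = \<pi> ` T}"
    by (rule even_perms_translate[OF assms])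
  show ?thesis
    unfolding transversal_coset_def
    by (subst weight_matrix_r_coset[OF _ assms]) (blast, simp only: eq)
qed

lemma index_coset_mult:
  assumes "\<pi> \<in> even_perms"
  shows "index_coset i #>\<^bsub>M\<^esub> weight_matrix \<pi> = index_coset (\<pi> i)"
proof -
  have "(\<pi> \<circ> \<sigma>) 6 = \<pi> i \<longleftrightarrow> \<sigma> 6 = i" for \<sigma>
    using signed_permsD(3)[OF even_perms_signed[OF assms]] by (simp add: inj_eq)
  then have eq: "(\<circ>) \<pi> ` {\<sigma> \<in> even_perms. \<sigma> 6 = i} = {\<sigma> \<in> even_perms. \<sigma> 6 = \<pi> i}"
    by (rule even_perms_translate[OF assms])
  show ?thesis
    unfolding index_coset_def
    by (subst weight_matrix_r_coset[OF _ assms]) (blast, simp only: eq)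
qed

section \<open>Counting pairs of even transversals\<close>

text \<open>The transversal whose intersection with T is K. A pair of transversals is thereby
  encoded by one member and a subset of it.\<close>

definition flip :: "int set \<Rightarrow> int set \<Rightarrow> int set"
  where "flip T K = K \<union> uminus ` (T - K)"

lemma even_transversals_transversal: "T \<in> even_transversals \<Longrightarrow> transversal T"
  by (simp add: even_transversals_def)

text \<open>Exactly the elements of \<open>T - K\<close> change sign, and their number is 6 minus
  that of K.\<close>

lemma flip_even_transversals:
  assumes T: "T \<in> even_transversals" and K: "K \<subseteq> T"
  shows "flip T K \<in> even_transversals \<longleftrightarrow> even (card K)"
proof -
  note t = even_transversals_transversal[OF T]
  note fin = finite_transversal[OF t]
  have "T - flip T K = T - K"
    using transversal_flip(2)[OF t K] unfolding flip_def by blast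
  moreover have "card K + card (T - K) = 6"
    using card_Un_disjoint[of K "T - K"] fin K finite_subset[OF K fin] card_transversal[OF t]
    by (simp add: Un_absorb1)
  then have "even (card (T - K)) \<longleftrightarrow> even (card K)"
    by (metis even_add even_numeral)
  ultimately show ?thesis
    using even_transversals_iff[OF T transversal_flip(1)[OF t K]] by (simp add: flip_def)
qed

lemma flip_Int:
  assumes "T \<in> even_transversals" "T' \<in> even_transversals"
  shows "flip T (T \<inter> T') = T'"
  using transversal_eq_flip[OF assms[THEN even_transversals_transversal]]
  by (simp add: flip_def Diff_Int)

lemma even_card_Int:
  assumes "T \<in> even_transversals" "T' \<in> even_transversals"
  shows "even (card (T \<inter> T'))"
  using flip_even_transversals[OF assms(1), of "T \<inter> T'"] flip_Int[OF assms] assms by simp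

lemma card_Int_less:
  assumes "T \<in> even_transversals" "T' \<in> even_transversals" "T \<noteq> T'"
  shows "card (T \<inter> T') < 6"
proof -
  note t = assms(1,2)[THEN even_transversals_transversal]
  have "T \<inter> T' \<noteq> T"
  proof
    assume "T \<inter> T' = T"
    then have "T = T'"
      using card_subset_eq[OF finite_transversal[OF t(2)], of T] card_transversal t by auto
    then show False using assms(3) by simp
  qed
  then have "T \<inter> T' \<subset> T" by blast
  then show ?thesis
    using psubset_card_mono[OF finite_transversal[OF t(1)]] card_transversal[OF t(1)] by metis
qed

text \<open>An even transversal corresponds to the set of positive letters it omits, an even subset
  of six: 1 + 15 + 15 + 1.\<close>

lemma card_even_transversals: "card even_transversals = 32"
proof -
  let ?N = "{N. N \<subseteq> positives \<and> even (card N)}"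
  have cp: "card positives = 6" "finite positives" by (simp_all add: positives_def)
  have "bij_betw (\<lambda>T. positives - T) even_transversals ?N"
  proof (rule bij_betw_byWitness[where f' = "\<lambda>N. flip positives (positives - N)"])
    show "\<forall>T\<in>even_transversals. flip positives (positives - (positives - T)) = T"
      using flip_Int[OF positives_even] by (simp add: Diff_Diff_Int)
    have int: "positives \<inter> flip positives (positives - N) = positives - N" for N
      using transversal_flip(2)[OF transversal_positives, of "positives - N"] by (simp add: flip_def)
    then show "\<forall>N\<in>?N. positives - flip positives (positives - N) = N" by blast
    show "(\<lambda>T. positives - T) ` even_transversals \<subseteq> ?N"
      by (auto simp: even_transversals_def)
    show "(\<lambda>N. flip positives (positives - N)) ` ?N \<subseteq> even_transversals"
    proof clarsimp
      fix N assume N: "N \<subseteq> positives" "even (card N)"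
      then have "card (positives - N) = 6 - card N" "card N \<le> 6"
        using cp card_Diff_subset[of N positives] card_mono[of positives N] finite_subset by auto
      then show "flip positives (positives - N) \<in> even_transversals"
        using flip_even_transversals[OF positives_even, of "positives - N"] N(2) by simp
    qed
  qed
  then have "card even_transversals = card ?N" by (rule bij_betw_same_card)
  also have "?N = (\<Union>k\<in>{0, 2, 4, 6}. {N. N \<subseteq> positives \<and> card N = k})"
  proof -
    have "card N \<in> {0, 2, 4, 6}" if "N \<subseteq> positives" "even (card N)" for N
    proof -
      have "card N \<le> 6" using that card_mono[of positives N] cp by simp
      then have "card N \<in> {0, 1, 2, 3, 4, 5, 6}" by auto
      then show ?thesis using that(2) by auto
    qed
    then have "?N \<subseteq> (\<Union>k\<in>{0, 2, 4, 6}. {N. N \<subseteq> positives \<and> card N = k})" by blast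
    then show ?thesis by (intro subset_antisym) auto
  qed
  also have "card \<dots> = (\<Sum>k\<in>{0, 2, 4, 6}. card {N. N \<subseteq> positives \<and> card N = k})"
    using cp by (intro card_UN_disjoint) auto
  also have "\<dots> = 32"
    using cp by (simp add: n_subsets choose_two numeral_eq_Suc)
  finally show ?thesis .
qed

definition pairs :: "nat \<Rightarrow> int set set set"
  where "pairs k = {P. P \<subseteq> even_transversals \<and> card P = 2 \<and> card (\<Inter>P) = k}"

lemma finite_even_transversals: "finite even_transversals"
  using card_even_transversals by (metis card.infinite zero_neq_numeral)

lemma finite_pairs: "finite (pairs k)"
  by (rule finite_subset[of _ "Pow even_transversals"]) (auto simp: pairs_def finite_even_transversals)

lemma pair_other:
  assumes "card P = 2" "T \<in> P"
  obtains T' where "P = {T, T'}" "T \<noteq> T'"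
proof -
  obtain A B where "P = {A, B}" "A \<noteq> B" using assms(1) by (meson card_2_iff)
  then show ?thesis using that[of A] that[of B] assms(2) by (auto simp: insert_commute)
qed

text \<open>Pairs with a chosen member T correspond to an even transversal T with a k-element subset
  K, the other member being \<open>flip T K\<close>. Counting both sides gives
  \<open>2 * card (pairs k) = 32 * (6 choose k)\<close>. For k = 6 the flip would be T
  itself.\<close>

lemma card_pairs:
  assumes "even k" "k < 6"
  shows "card (pairs k) = 16 * (6 choose k)"
proof -
  have "bij_betw (\<lambda>(P, T). (T, \<Inter>P)) (SIGMA P:pairs k. P)
    (SIGMA T:even_transversals. {K. K \<subseteq> T \<and> card K = k})"
  proof (rule bij_betw_byWitness[where f' = "\<lambda>(T, K). ({T, flip T K}, T)"])
    show "\<forall>x\<in>SIGMA P:pairs k. P. (\<lambda>(T, K). ({T, flip T K}, T)) ((\<lambda>(P, T). (T, \<Inter>P)) x) = x"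
    proof clarsimp
      fix P T assume P: "P \<in> pairs k" and T: "T \<in> P"
      then obtain T' where T': "P = {T, T'}" by (auto simp: pairs_def elim: pair_other)
      then show "{T, flip T (\<Inter>P)} = P"
        using flip_Int P by (auto simp: pairs_def)
    qed
    have flip: "transversal T" "T \<inter> flip T K = K" "flip T K \<in> even_transversals" "T \<noteq> flip T K"
      if "T \<in> even_transversals" "K \<subseteq> T" "card K = k" for T K
    proof -
      show t: "transversal T" using that(1) by (rule even_transversals_transversal)
      show int: "T \<inter> flip T K = K"
        using transversal_flip(2)[OF t that(2)] by (simp add: flip_def)
      show "flip T K \<in> even_transversals"
        using flip_even_transversals[OF that(1,2)] that(3) assms(1) by simp
      show "T \<noteq> flip T K"
        using int that(3) card_transversal[OF t] assms(2) by auto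
    qed
    show "\<forall>x\<in>SIGMA T:even_transversals. {K. K \<subseteq> T \<and> card K = k}.
        (\<lambda>(P, T). (T, \<Inter>P)) ((\<lambda>(T, K). ({T, flip T K}, T)) x) = x"
      using flip(2) by auto
    show "(\<lambda>(P, T). (T, \<Inter>P)) ` (SIGMA P:pairs k. P) \<subseteq>
      (SIGMA T:even_transversals. {K. K \<subseteq> T \<and> card K = k})"
      by (auto simp: pairs_def)
    show "(\<lambda>(T, K). ({T, flip T K}, T)) ` (SIGMA T:even_transversals. {K. K \<subseteq> T \<and> card K = k})
      \<subseteq> (SIGMA P:pairs k. P)"
    proof clarsimp
      fix T K assume "T \<in> even_transversals" "K \<subseteq> T" "k = card K"
      then show "{T, flip T K} \<in> pairs (card K)"
        using flip[of T K] by (simp add: pairs_def)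
    qed
  qed
  then have "card (SIGMA P:pairs k. P) = card (SIGMA T:even_transversals. {K. K \<subseteq> T \<and> card K = k})"
    by (rule bij_betw_same_card)
  moreover have "card (SIGMA P:pairs k. P) = (\<Sum>P\<in>pairs k. card P)"
    using finite_pairs by (intro card_SigmaI) (auto simp: pairs_def intro: card_ge_0_finite)
  moreover have "card (SIGMA T:even_transversals. {K. K \<subseteq> T \<and> card K = k})
    = (\<Sum>T\<in>even_transversals. card {K. K \<subseteq> T \<and> card K = k})"
    using finite_even_transversals
    by (intro card_SigmaI)
      (auto intro: finite_subset[OF _ finite_Pow_iff[THEN iffD2, OF finite_transversal]] even_transversals_transversal)
  moreover have "(\<Sum>P\<in>pairs k. card P) = 2 * card (pairs k)"
    by (simp add: pairs_def)
  moreover have "(\<Sum>T\<in>even_transversals. card {K. K \<subseteq> T \<and> card K = k}) = 32 * (6 choose k)"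
    by (simp add: n_subsets finite_transversal even_transversals_transversal card_transversal
        card_even_transversals)
  ultimately show ?thesis by simp
qed

section \<open>Orbits of signed permutations on marked pairs\<close>

definition marked_pairs :: "(int \<times> int set set) set"
  where "marked_pairs = signed \<times> {P. P \<subseteq> even_transversals \<and> card P = 2}"

definition perm_act :: "(int \<Rightarrow> int) \<Rightarrow> int \<times> int set set \<Rightarrow> int \<times> int set set"
  where "perm_act \<pi> = (\<lambda>(i, P). (\<pi> i, (\<lambda>T. \<pi> ` T) ` P))"

definition kind :: "int \<times> int set set \<Rightarrow> nat \<times> bool \<times> bool"
  where "kind = (\<lambda>(i, P). (card (\<Inter>P), i \<in> \<Inter>P, - i \<in> \<Inter>P))"

definition of_kind :: "nat \<times> bool \<times> bool \<Rightarrow> (int \<times> int set set) set"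
  where "of_kind v = {y \<in> marked_pairs. kind y = v}"

lemma Inter_pair:
  assumes "P \<subseteq> even_transversals" "card P = 2"
  shows "\<Inter>P \<subseteq> signed" "finite (\<Inter>P)"
    "i \<in> \<Inter>P \<Longrightarrow> - i \<notin> \<Inter>P"
proof -
  obtain A B where P: "P = {A, B}" using assms(2) by (meson card_2_iff)
  then have A: "transversal A" using assms(1) by (auto intro: even_transversals_transversal)
  show "\<Inter>P \<subseteq> signed" using transversalD(1)[OF A] P by auto
  then show "finite (\<Inter>P)" using finite_signed by (rule finite_subset)
  show "i \<in> \<Inter>P \<Longrightarrow> - i \<notin> \<Inter>P" using transversalD(2)[OF A] P by auto
qed

lemma card_of_kind:
  assumes k: "even k" "k < 6"
  shows "card (of_kind (k, True, False)) = 16 * (6 choose k) * k"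
    "card (of_kind (k, False, True)) = 16 * (6 choose k) * k"
    "card (of_kind (k, False, False)) = 16 * (6 choose k) * (12 - 2 * k)"
proof -
  let ?C = "\<lambda>b c P. {i \<in> signed. (i \<in> \<Inter>P) = b \<and> (- i \<in> \<Inter>P) = c}"
  have *: "card (of_kind (k, b, c)) = 16 * (6 choose k) * n"
    if "\<And>P. P \<in> pairs k \<Longrightarrow> card (?C b c P) = n" for b c n
  proof -
    have "of_kind (k, b, c) = prod.swap ` (SIGMA P:pairs k. ?C b c P)"
      by (auto simp: of_kind_def marked_pairs_def kind_def pairs_def image_iff)
    then have "card (of_kind (k, b, c)) = card (SIGMA P:pairs k. ?C b c P)"
      by (simp add: card_image)
    also have "\<dots> = (\<Sum>P\<in>pairs k. card (?C b c P))"
      using finite_pairs by (intro card_SigmaI) auto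
    also have "\<dots> = 16 * (6 choose k) * n"
      using that card_pairs[OF k] by simp
    finally show ?thesis .
  qed
  have P: "\<Inter>P \<subseteq> signed" "finite (\<Inter>P)" "card (\<Inter>P) = k" "\<And>i. i \<in> \<Inter>P \<Longrightarrow> - i \<notin> \<Inter>P"
    if "P \<in> pairs k" for P
    using Inter_pair[of P] that unfolding pairs_def by blast+
  have in_P: "?C True False P = \<Inter>P" if "P \<in> pairs k" for P
    using P(1,4)[OF that] by blast
  have neg_P: "?C False True P = uminus ` \<Inter>P" if "P \<in> pairs k" for P
  proof (intro Set.set_eqI iffI)
    fix i assume "i \<in> ?C False True P"
    then show "i \<in> uminus ` \<Inter>P" by (intro image_eqI[of _ _ "- i"]) auto
  next
    fix i assume "i \<in> uminus ` \<Inter>P"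
    then obtain j where j: "i = - j" "j \<in> \<Inter>P" by blast
    then have "j \<in> signed" "- j \<notin> \<Inter>P" using P(1,4)[OF that] by blast+
    then show "i \<in> ?C False True P" using j by simp
  qed
  have card_neg: "card (uminus ` \<Inter>P) = k" if "P \<in> pairs k" for P
    using P(3)[OF that] by (simp add: card_image)
  show "card (of_kind (k, True, False)) = 16 * (6 choose k) * k"
    by (rule *) (simp only: in_P P(3))
  show "card (of_kind (k, False, True)) = 16 * (6 choose k) * k"
    by (rule *) (simp only: neg_P card_neg)
  show "card (of_kind (k, False, False)) = 16 * (6 choose k) * (12 - 2 * k)"
  proof (rule *)
    fix P assume P': "P \<in> pairs k"
    have disj: "\<Inter>P \<inter> uminus ` \<Inter>P = {}"
      using P(4)[OF P'] by blast
    have sub: "\<Inter>P \<union> uminus ` \<Inter>P \<subseteq> signed"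
      using P(1)[OF P'] by fastforce
    have "?C False False P = signed - (\<Inter>P \<union> uminus ` \<Inter>P)"
      using neg_P[OF P'] P(4)[OF P'] by blast
    then have "card (?C False False P) = card signed - card (\<Inter>P \<union> uminus ` \<Inter>P)"
      using card_Diff_subset[OF _ sub] P(2)[OF P'] by simp
    also have "card (\<Inter>P \<union> uminus ` \<Inter>P) = 2 * k"
      using card_Un_disjoint[OF P(2)[OF P'] _ disj] P(2,3)[OF P'] card_neg[OF P'] by simp
    finally show "card (?C False False P) = 12 - 2 * k"
      by (simp add: signed_eq)
  qed
qed

lemma kind_perm_act:
  assumes \<pi>: "\<pi> \<in> even_perms" and y: "y \<in> marked_pairs"
  shows "perm_act \<pi> y \<in> marked_pairs" "kind (perm_act \<pi> y) = kind y"
proof -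
  obtain i P where iP: "y = (i, P)" by (cases y)
  have P: "i \<in> signed" "P \<subseteq> even_transversals" "card P = 2"
    using y iP by (auto simp: marked_pairs_def)
  note s = signed_permsD[OF even_perms_signed[OF \<pi>]]
  have "inj_on (\<lambda>T. \<pi> ` T) P"
    by (rule inj_onI) (simp add: inj_image_eq_iff[OF s(3)])
  then have "card ((\<lambda>T. \<pi> ` T) ` P) = 2"
    using P(3) by (simp add: card_image)
  then show "perm_act \<pi> y \<in> marked_pairs"
    using P s(5) even_perms_image[OF \<pi>] iP by (auto simp: perm_act_def marked_pairs_def)
  have "\<Inter>((\<lambda>T. \<pi> ` T) ` P) = \<pi> ` \<Inter>P"
  proof -
    obtain A B where "P = {A, B}" using P(3) by (meson card_2_iff)
    then show ?thesis by (simp add: image_Int[OF s(3)])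
  qed
  then show "kind (perm_act \<pi> y) = kind y"
    using iP inj_image_mem_iff[OF s(3)] s(2)[of i, symmetric] s(3)
    by (simp add: kind_def perm_act_def card_image inj_on_subset)
qed

text \<open>If \<open>- i\<close> is not common to both members, one that omits it contains i; that
  one is named T.\<close>

lemma marked_pair_pointed:
  assumes "(i, P) \<in> marked_pairs" "i \<in> \<Inter>P \<or> - i \<notin> \<Inter>P"
  obtains T T' where "P = {T, T'}" "T \<in> even_transversals" "T' \<in> even_transversals" "i \<in> T"
    "\<Inter>P = T \<inter> T'"
proof -
  have P: "i \<in> signed" "P \<subseteq> even_transversals" "card P = 2"
    using assms(1) by (auto simp: marked_pairs_def)
  obtain A B where AB: "P = {A, B}" using P(3) by (meson card_2_iff)
  have "i \<in> A \<or> - i \<in> A" "i \<in> B \<or> - i \<in> B"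
    using P AB transversalD(3)[OF even_transversals_transversal] by blast+
  then have "i \<in> A \<or> i \<in> B" using assms(2) AB by auto
  then show ?thesis
    using that[of A B] that[of B A] AB P(2) by auto
qed

text \<open>Only the first members, the intersections and the letters are matched explicitly. A
  signed permutation commutes with negation, so it then carries
  \<open>flip T (T \<inter> T')\<close>, that is T', to U'.\<close>

lemma perm_act_transitive:
  assumes y: "(i, P) \<in> marked_pairs" "(j, Q) \<in> marked_pairs" and kind: "kind (i, P) = kind (j, Q)"
  obtains \<pi> where "\<pi> \<in> even_perms" "perm_act \<pi> (i, P) = (j, Q)"
proof -
  text \<open>Replacing both marks by their negatives, the mark may be assumed to lie in some member of the pair.\<close>
  obtain s :: int where s: "s = 1 \<or> s = - 1" "s * i \<in> \<Inter>P \<or> - (s * i) \<notin> \<Inter>P"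
    by (cases "- i \<in> \<Inter>P") (use that[of 1] that[of "- 1"] in auto)
  have k: "card (\<Inter>P) = card (\<Inter>Q)" "s * i \<in> \<Inter>P \<longleftrightarrow> s * j \<in> \<Inter>Q" "- (s * i) \<in> \<Inter>P \<longleftrightarrow> - (s * j) \<in> \<Inter>Q"
    using kind s(1) by (auto simp: kind_def)
  have m: "(s * i, P) \<in> marked_pairs" "(s * j, Q) \<in> marked_pairs"
    using y s(1) by (auto simp: marked_pairs_def)
  obtain T T' where T: "P = {T, T'}" "T \<in> even_transversals" "T' \<in> even_transversals" "s * i \<in> T"
    "\<Inter>P = T \<inter> T'"
    by (rule marked_pair_pointed[OF m(1) s(2)])
  have "s * j \<in> \<Inter>Q \<or> - (s * j) \<notin> \<Inter>Q" using s(2) unfolding k(2,3) .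
  from marked_pair_pointed[OF m(2) this]
  obtain U U' where U: "Q = {U, U'}" "U \<in> even_transversals" "U' \<in> even_transversals" "s * j \<in> U"
    "\<Inter>Q = U \<inter> U'" .
  obtain \<pi> where \<pi>: "\<pi> \<in> even_perms" "\<pi> ` T = U" "\<pi> ` (T \<inter> T') = U \<inter> U'" "\<pi> (s * i) = s * j"
    by (rule even_perms_exists[OF T(2) U(2) _ _ _ T(4) U(4), of "T \<inter> T'" "U \<inter> U'"])
      (use k(1,2) T(4,5) U(4,5) in auto)
  note sp = signed_permsD[OF even_perms_signed[OF \<pi>(1)]]
  have "\<pi> ` T' = \<pi> ` (T \<inter> T') \<union> uminus ` (\<pi> ` T - \<pi> ` (T \<inter> T'))"
  proof -
    have "\<pi> ` uminus ` A = uminus ` \<pi> ` A" for A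
      by (simp add: image_image sp(2))
    then have "\<pi> ` flip T (T \<inter> T') = \<pi> ` (T \<inter> T') \<union> uminus ` (\<pi> ` T - \<pi> ` (T \<inter> T'))"
      unfolding flip_def by (simp only: image_Un image_set_diff[OF sp(3)])
    then show ?thesis using flip_Int[OF T(2,3)] by simp
  qed
  also have "\<dots> = U'"
    using flip_Int[OF U(2,3)] by (simp add: \<pi>(2,3) flip_def)
  finally have "\<pi> ` T' = U'" .
  moreover have "\<pi> i = j"
    using \<pi>(4) s(1) sp(2)[of i] by auto
  ultimately show ?thesis
    using that[OF \<pi>(1)] \<pi>(2) T(1) U(1) by (simp add: perm_act_def)
qed

lemma perm_act_orbit:
  assumes "y \<in> marked_pairs"
  shows "(\<lambda>\<pi>. perm_act \<pi> y) ` even_perms = of_kind (kind y)"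
proof (intro Set.set_eqI iffI)
  fix z assume "z \<in> (\<lambda>\<pi>. perm_act \<pi> y) ` even_perms"
  then show "z \<in> of_kind (kind y)"
    using kind_perm_act[OF _ assms] by (auto simp: of_kind_def)
next
  fix z assume z: "z \<in> of_kind (kind y)"
  obtain i P j Q where yz: "y = (i, P)" "z = (j, Q)" by (cases y, cases z)
  have z': "z \<in> marked_pairs" "kind y = kind z"
    using z by (simp_all add: of_kind_def)
  obtain \<pi> where "\<pi> \<in> even_perms" "perm_act \<pi> y = z"
    using perm_act_transitive[OF assms[unfolded yz(1)] z'(1)[unfolded yz(2)] z'(2)[unfolded yz]]
    unfolding yz by metis
  then show "z \<in> (\<lambda>\<pi>. perm_act \<pi> y) ` even_perms" by blast
qed

section \<open>Cosets and marked pairs\<close>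

definition cosets_of :: "int \<times> int set set \<Rightarrow> (complex^7^7) set \<times> (complex^7^7) set set"
  where "cosets_of = (\<lambda>(i, P). (index_coset i, transversal_coset ` P))"

lemma even_transversal_containing:
  assumes "i \<in> signed"
  obtains T where "T \<in> even_transversals" "i \<in> T"
proof (cases "i \<in> positives")
  case True
  then show ?thesis using that positives_even by blast
next
  case False
  \<comment> \<open>The all-negative transversal is even because six is.\<close>
  have "flip positives {} \<in> even_transversals"
    using flip_even_transversals[OF positives_even] by simp
  moreover have "i \<in> flip positives {}"
    using False transversalD(3)[OF transversal_positives assms] by (force simp: flip_def)
  ultimately show ?thesis using that by blast
qed

lemma even_perm_sending_6:
  assumes "i \<in> signed"
  obtains \<pi> where "\<pi> \<in> even_perms" "\<pi> 6 = i"
proof -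
  obtain T where T: "T \<in> even_transversals" "i \<in> T"
    using even_transversal_containing[OF assms] .
  show ?thesis
    by (rule even_perms_exists[OF positives_even T(1), of "{}" "{}" 6 i])
      (use T that in \<open>auto simp: positives_def\<close>)
qed

lemma even_perm_onto:
  assumes "T \<in> even_transversals"
  obtains \<pi> where "\<pi> \<in> even_perms" "\<pi> ` positives = T"
proof -
  have "T \<noteq> {}"
    using card_transversal[OF even_transversals_transversal[OF assms]] by auto
  then obtain j where j: "j \<in> T" by blast
  show ?thesis
    by (rule even_perms_exists[OF positives_even assms, of "{}" "{}" 6 j])
      (use j that in \<open>auto simp: positives_def\<close>)
qed

text \<open>No such coset is empty, by transitivity, and any matrix in it determines its permutation
  and hence the label.\<close>

lemma inj_on_transversal_coset: "inj_on transversal_coset even_transversals"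
proof (rule inj_onI)
  fix T T' assume T: "T \<in> even_transversals" and eq: "transversal_coset T = transversal_coset T'"
  obtain \<pi> where \<pi>: "\<pi> \<in> even_perms" "\<pi> ` positives = T" by (rule even_perm_onto[OF T])
  then have "weight_matrix \<pi> \<in> transversal_coset T'"
    unfolding eq[symmetric] by (auto simp: transversal_coset_def)
  then obtain \<sigma> where \<sigma>: "\<sigma> \<in> even_perms" "\<sigma> ` positives = T'" "weight_matrix \<pi> = weight_matrix \<sigma>"
    by (auto simp: transversal_coset_def)
  then have "\<pi> = \<sigma>" using \<pi>(1) by (intro weight_matrix_inj even_perms_signed)
  then show "T = T'" using \<pi>(2) \<sigma>(2) by simp
qed

lemma inj_on_index_coset: "inj_on index_coset signed"
proof (rule inj_onI)
  fix i j assume i: "i \<in> signed" and eq: "index_coset i = index_coset j"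
  obtain \<pi> where \<pi>: "\<pi> \<in> even_perms" "\<pi> 6 = i" by (rule even_perm_sending_6[OF i])
  then have "weight_matrix \<pi> \<in> index_coset j"
    unfolding eq[symmetric] by (auto simp: index_coset_def)
  then obtain \<sigma> where \<sigma>: "\<sigma> \<in> even_perms" "\<sigma> 6 = j" "weight_matrix \<pi> = weight_matrix \<sigma>"
    by (auto simp: index_coset_def)
  then have "\<pi> = \<sigma>" using \<pi>(1) by (intro weight_matrix_inj even_perms_signed)
  then show "i = j" using \<pi>(2) \<sigma>(2) by simp
qed

lemma rcosets_G\<^sub>K: "rcosets\<^bsub>M\<^esub> G\<^sub>K = transversal_coset ` even_transversals"
proof -
  have "rcosets\<^bsub>M\<^esub> G\<^sub>K = (\<lambda>\<pi>. transversal_coset (\<pi> ` positives)) ` even_perms"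
    unfolding RCOSETS_def carrier_M G\<^sub>K_eq transversal_coset_def[symmetric]
    using transversal_coset_mult by auto
  also have "\<dots> = transversal_coset ` (\<lambda>\<pi>. \<pi> ` positives) ` even_perms"
    by (simp only: image_image)
  also have "(\<lambda>\<pi>. \<pi> ` positives) ` even_perms = even_transversals"
    using even_perms_image[OF _ positives_even] by (force elim: even_perm_onto)
  finally show ?thesis .
qed

lemma rcosets_G\<^sub>L: "rcosets\<^bsub>M\<^esub> G\<^sub>L = index_coset ` signed"
proof -
  have "rcosets\<^bsub>M\<^esub> G\<^sub>L = (\<lambda>\<pi>. index_coset (\<pi> 6)) ` even_perms"
    unfolding RCOSETS_def carrier_M G\<^sub>L_eq index_coset_def[symmetric]
    using index_coset_mult by auto
  also have "\<dots> = index_coset ` (\<lambda>\<pi>. \<pi> 6) ` even_perms"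
    by (simp only: image_image)
  also have "(\<lambda>\<pi>. \<pi> 6) ` even_perms = signed"
  proof -
    have "\<pi> 6 \<in> signed" if "\<pi> \<in> even_perms" for \<pi>
      using signed_permsD(5)[OF even_perms_signed[OF that], of 6] by (simp add: signed_def)
    then show ?thesis by (force elim: even_perm_sending_6)
  qed
  finally show ?thesis .
qed

text \<open>Injectivity of the labelling is what makes two-element sets of cosets correspond to
  two-element sets of transversals.\<close>

lemma S_LK2_eq: "S_LK2 = cosets_of ` marked_pairs"
proof -
  have "{P. P \<subseteq> transversal_coset ` even_transversals \<and> card P = 2}
    = (\<lambda>P. transversal_coset ` P) ` {P. P \<subseteq> even_transversals \<and> card P = 2}" (is "?A = ?B")
  proof (intro Set.set_eqI iffI)
    fix P assume P: "P \<in> ?A"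
    then obtain Q where Q: "Q \<subseteq> even_transversals" "P = transversal_coset ` Q"
      by (auto elim: subset_imageE)
    have "card P = card Q"
      unfolding Q(2) by (rule card_image, rule inj_on_subset[OF inj_on_transversal_coset Q(1)])
    then show "P \<in> ?B" using P Q(1,2) by auto
  next
    fix P assume "P \<in> ?B"
    then obtain Q where Q: "Q \<subseteq> even_transversals" "P = transversal_coset ` Q" "card Q = 2" by auto
    have "card P = card Q"
      unfolding Q(2) by (rule card_image, rule inj_on_subset[OF inj_on_transversal_coset Q(1)])
    then show "P \<in> ?A" using Q by (simp add: image_mono)
  qed
  then have "S_LK2 = index_coset ` signed \<times>
      (\<lambda>P. transversal_coset ` P) ` {P. P \<subseteq> even_transversals \<and> card P = 2}"
    by (simp only: S_LK2_def rcosets_G\<^sub>K rcosets_G\<^sub>L)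
  also have "\<dots> = cosets_of ` marked_pairs"
    unfolding cosets_of_def marked_pairs_def by force
  finally show ?thesis .
qed

lemma inj_on_cosets_of: "inj_on cosets_of marked_pairs"
proof (rule inj_onI)
  fix y z assume "y \<in> marked_pairs" "z \<in> marked_pairs" and eq: "cosets_of y = cosets_of z"
  then obtain i P j Q where yz: "y = (i, P)" "z = (j, Q)" "i \<in> signed" "j \<in> signed"
    "P \<subseteq> even_transversals" "Q \<subseteq> even_transversals"
    by (auto simp: marked_pairs_def)
  then have "index_coset i = index_coset j" "transversal_coset ` P = transversal_coset ` Q"
    using eq by (simp_all add: cosets_of_def)
  then show "y = z"
    using yz inj_on_eq_iff[OF inj_on_index_coset] inj_on_image_eq_iff[OF inj_on_transversal_coset]
    by simp
qed

lemma right_mult_cosets_of: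
  assumes "\<pi> \<in> even_perms"
  shows "right_mult (weight_matrix \<pi>) (cosets_of y) = cosets_of (perm_act \<pi> y)"
  by (cases y) (simp add: right_mult_def cosets_of_def perm_act_def image_image
      transversal_coset_mult[OF assms] index_coset_mult[OF assms])

lemma M_orbit_cosets_of:
  assumes "y \<in> marked_pairs"
  shows "M_orbit (cosets_of y) = cosets_of ` of_kind (kind y)"
proof -
  have "M_orbit (cosets_of y) = (\<lambda>\<pi>. right_mult (weight_matrix \<pi>) (cosets_of y)) ` even_perms"
    unfolding orbit_def carrier_M by blast
  also have "\<dots> = cosets_of ` (\<lambda>\<pi>. perm_act \<pi> y) ` even_perms"
    by (simp add: image_image right_mult_cosets_of cong: image_cong_simp)
  also have "\<dots> = cosets_of ` of_kind (kind y)"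
    by (simp only: perm_act_orbit[OF assms])
  finally show ?thesis .
qed

lemma card_M_orbit:
  assumes "y \<in> marked_pairs"
  shows "card (M_orbit (cosets_of y)) = card (of_kind (kind y))"
  unfolding M_orbit_cosets_of[OF assms]
  by (rule card_image, rule inj_on_subset[OF inj_on_cosets_of]) (auto simp: of_kind_def)

section \<open>The labelled cosets\<close>

lemma elt_acting_as_eq:
  assumes \<pi>: "\<pi> \<in> even_perms"
    and F: "\<And>x i. level x = 1 \<Longrightarrow> i \<in> positives \<Longrightarrow> weight i (coord_map F x) = weight (\<pi> i) x"
      "\<And>x. level x = 1 \<Longrightarrow> level (coord_map F x) = 1"
  shows "elt_acting_as F = weight_matrix \<pi>"
  unfolding elt_acting_as_def
proof (rule the_equality)
  note s = even_perms_signed[OF \<pi>]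
  have act: "weight_matrix \<pi> *v x = coord_map F x" if "x \<in> V" for x
  proof (rule weights_eqI)
    show "weight i (weight_matrix \<pi> *v x) = weight i (coord_map F x)" if "i \<in> positives" for i
      using that F(1) \<open>x \<in> V\<close> by (simp add: weight_mult[OF s] level_V positives_def signed_def)
    show "level (weight_matrix \<pi> *v x) = level (coord_map F x)"
      using F(2) that by (simp add: level_mult[OF s] level_V)
  qed
  then show "weight_matrix \<pi> \<in> carrier M \<and> (\<forall>x\<in>V. weight_matrix \<pi> *v x = coord_map F x)"
    using \<pi> by (simp add: carrier_M)
  fix A assume "A \<in> carrier M \<and> (\<forall>x\<in>V. A *v x = coord_map F x)"
  then show "A = weight_matrix \<pi>"
    using act by (intro matrix_determined_on_V) simp
qed

text \<open>\<open>j1\<close> to \<open>j6\<close> are the letters to which 1 to 6 are sent, found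
  by writing the weights of the image under F in terms of the old weights on V. The whole set
  matters for \<open>K_coset\<close>, the last entry alone for \<open>L_coset\<close>.\<close>

lemma
  assumes j: "set [j1, j2, j3, j4, j5, j6] \<in> even_transversals"
    and F: "\<And>x. level x = 1 \<Longrightarrow> level (coord_map F x) = 1 \<and>
      weight 1 (coord_map F x) = weight j1 x \<and> weight 2 (coord_map F x) = weight j2 x \<and>
      weight 3 (coord_map F x) = weight j3 x \<and> weight 4 (coord_map F x) = weight j4 x \<and>
      weight 5 (coord_map F x) = weight j5 x \<and> weight 6 (coord_map F x) = weight j6 x"
  shows K_coset_eq: "K_coset F = transversal_coset {j1, j2, j3, j4, j5, j6}"
    and L_coset_eq: "L_coset F = index_coset j6"
proof -
  define f where "f i = [j1, j2, j3, j4, j5, j6] ! nat (i - 1)" for i :: int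
  have f: "f 1 = j1" "f 2 = j2" "f 3 = j3" "f 4 = j4" "f 5 = j5" "f 6 = j6"
    by (simp_all add: f_def)
  have im: "f ` positives = set [j1, j2, j3, j4, j5, j6]"
    by (simp add: positives_eq f)
  \<comment> \<open>Six values on six letters force f to be injective.\<close>
  have "card (f ` positives) = 6"
    unfolding im using card_transversal[OF even_transversals_transversal[OF j]] .
  then have "inj_on f positives"
    by (intro eq_card_imp_inj_on) (auto simp: positives_eq)
  then have "bij_betw f positives (set [j1, j2, j3, j4, j5, j6])"
    unfolding im[symmetric] by (rule inj_on_imp_bij_betw)
  from even_perms_extend[OF positives_even j this]
  obtain \<pi> where \<pi>: "\<pi> \<in> even_perms" "\<And>i. i \<in> positives \<Longrightarrow> \<pi> i = f i" by metis
  have elt: "elt_acting_as F = weight_matrix \<pi>"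
  proof (rule elt_acting_as_eq[OF \<pi>(1)])
    fix x and i :: int assume x: "level x = 1"
    show "weight i (coord_map F x) = weight (\<pi> i) x" if i: "i \<in> positives"
    proof -
      have "weight i (coord_map F x) = weight (f i) x"
        using i F[OF x] by (auto simp: positives_eq f)
      then show ?thesis using \<pi>(2)[OF i] by simp
    qed
  qed (use F in blast)
  have "\<pi> ` positives = f ` positives"
    using \<pi>(2) by (rule image_cong[OF refl])
  then show "K_coset F = transversal_coset {j1, j2, j3, j4, j5, j6}"
    unfolding K_coset_def elt G\<^sub>K_eq transversal_coset_def[symmetric] transversal_coset_mult[OF \<pi>(1)]
    by (simp add: im)
  have "\<pi> 6 = j6" using \<pi>(2)[of 6] f by (simp add: positives_def)
  then show "L_coset F = index_coset j6"
    unfolding L_coset_def elt G\<^sub>L_eq index_coset_def[symmetric] index_coset_mult[OF \<pi>(1)]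
    by simp
qed

text \<open>Each list gives the images of 1 to 6, in this order, under one of the label maps. Eight
  lists serve ten labels, since the identity and the negation of all weights each label a coset of
  either group.\<close>

lemma explicit_even_transversals:
  "set [1, 2, 3, 4, 5, 6] \<in> even_transversals" "set [3, -2, -1, 4, 5, 6] \<in> even_transversals"
  "set [-1, -2, -3, -4, -5, -6] \<in> even_transversals" "set [-1, -2, -3, -6, 5, 4] \<in> even_transversals"
  "set [1, 2, 3, 6, 5, 4] \<in> even_transversals" "set [4, 5, 6, 1, 2, 3] \<in> even_transversals"
  "set [-1, -2, -3, -6, -5, -4] \<in> even_transversals" "set [-4, -5, -6, -3, -2, -1] \<in> even_transversals"
  by (simp_all add: even_transversals_def transversal_def signed_eq positives_eq insert_Diff_if)

text \<open>Solved for the last coordinate, so that as a rewrite rule it eliminates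
  \<open>x $ 7\<close>.\<close>

lemma level_eq_1_iff: "level x = 1 \<longleftrightarrow> x $ 7 = 1 + x $ 1 + x $ 2 + x $ 3 + x $ 4 - x $ 5 - x $ 6"
  by (auto simp: level_def algebra_simps)

lemma label_cosets:
  "p\<^sub>0 = transversal_coset {1, 2, 3, 4, 5, 6}" "p\<^sub>1 = transversal_coset {3, -2, -1, 4, 5, 6}"
  "n\<^sub>0 = transversal_coset {-1, -2, -3, -4, -5, -6}" "n\<^sub>4 = transversal_coset {-1, -2, -3, -6, 5, 4}"
  "l6 = index_coset 6" "l4 = index_coset 4" "l3 = index_coset 3"
  "l6bar = index_coset (- 6)" "l4bar = index_coset (- 4)" "l1bar = index_coset (- 1)"
proof -
  note F = level_eq_1_iff weight_def coord_map_def
  note T = explicit_even_transversals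
  show "p\<^sub>0 = transversal_coset {1, 2, 3, 4, 5, 6}"
    unfolding p\<^sub>0_def by (rule K_coset_eq[OF T(1)]) (simp add: F)
  show "p\<^sub>1 = transversal_coset {3, -2, -1, 4, 5, 6}"
    unfolding p\<^sub>1_def by (rule K_coset_eq[OF T(2)]) (simp add: F)
  show "n\<^sub>0 = transversal_coset {-1, -2, -3, -4, -5, -6}"
    unfolding n\<^sub>0_def by (rule K_coset_eq[OF T(3)]) (simp add: F)
  show "n\<^sub>4 = transversal_coset {-1, -2, -3, -6, 5, 4}"
    unfolding n\<^sub>4_def by (rule K_coset_eq[OF T(4)]) (simp add: F)
  show "l6 = index_coset 6"
    unfolding l6_def by (rule L_coset_eq[OF T(1)]) (simp add: F)
  show "l4 = index_coset 4"
    unfolding l4_def by (rule L_coset_eq[OF T(5)]) (simp add: F)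
  show "l3 = index_coset 3"
    unfolding l3_def by (rule L_coset_eq[OF T(6)]) (simp add: F)
  show "l6bar = index_coset (- 6)"
    unfolding l6bar_def by (rule L_coset_eq[OF T(3)]) (simp add: F)
  show "l4bar = index_coset (- 4)"
    unfolding l4bar_def by (rule L_coset_eq[OF T(7)]) (simp add: F)
  show "l1bar = index_coset (- 1)"
    unfolding l1bar_def by (rule L_coset_eq[OF T(8)]) (simp add: F)
qed

text \<open>Sizes 2 and 4 each admit three positions of the letter; an empty intersection leaves
  only one.\<close>

lemma kind_cases:
  assumes "y \<in> marked_pairs"
  shows "kind y \<in> {(4, True, False), (4, False, True), (4, False, False), (2, True, False),
    (2, False, True), (2, False, False), (0, False, False)}"
proof -
  obtain i P where y: "y = (i, P)" by (cases y)
  then have P: "P \<subseteq> even_transversals" "card P = 2" using assms by (auto simp: marked_pairs_def)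
  then obtain T T' where T: "P = {T, T'}" "T \<noteq> T'" "T \<in> even_transversals" "T' \<in> even_transversals"
    by (metis card_2_iff insert_subset)
  have "card (\<Inter>P) < 6" "even (card (\<Inter>P))"
    using card_Int_less[OF T(3,4,2)] even_card_Int[OF T(3,4)] T(1) by simp_all
  moreover have "n \<in> {0, 2, 4}" if "n < 6" "even n" for n :: nat
  proof -
    have "n \<in> {0, 1, 2, 3, 4, 5}" using that(1) by auto
    then show ?thesis using that(2) by auto
  qed
  ultimately have card: "card (\<Inter>P) \<in> {0, 2, 4}" by blast
  define b c where "b = (i \<in> \<Inter>P)" and "c = (- i \<in> \<Inter>P)"
  have "\<not> (b \<and> c)" unfolding b_def c_def using Inter_pair(3)[OF P] by blast
  moreover have "\<not> b \<and> \<not> c" if "card (\<Inter>P) = 0"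
  proof -
    have "\<Inter>P = {}" using that card_0_eq[OF Inter_pair(2)[OF P]] by blast
    then show ?thesis unfolding b_def c_def by blast
  qed
  moreover have "kind y = (card (\<Inter>P), b, c)"
    by (simp only: y kind_def b_def c_def case_prod_conv)
  ultimately show ?thesis
    using card by (cases b; cases c; auto)
qed

section \<open>The seven orbits and their lengths\<close>

theorem proposition4p5:
  shows "card (orbits M S_LK2 right_mult) = 7
    \<and> orbits M S_LK2 right_mult =
      {M_orbit (l3, {p\<^sub>0, p\<^sub>1}),
       M_orbit (l6bar, {p\<^sub>0, p\<^sub>1}),
       M_orbit (l1bar, {p\<^sub>0, p\<^sub>1}),
       M_orbit (l4, {p\<^sub>0, n\<^sub>4}),
       M_orbit (l4bar, {p\<^sub>0, n\<^sub>4}),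
       M_orbit (l6bar, {p\<^sub>0, n\<^sub>4}),
       M_orbit (l6, {p\<^sub>0, n\<^sub>0})}
    \<and> {(l3, {p\<^sub>0, p\<^sub>1}), (l6bar, {p\<^sub>0, p\<^sub>1}), (l1bar, {p\<^sub>0, p\<^sub>1}),
       (l4, {p\<^sub>0, n\<^sub>4}), (l4bar, {p\<^sub>0, n\<^sub>4}), (l6bar, {p\<^sub>0, n\<^sub>4}),
       (l6, {p\<^sub>0, n\<^sub>0})} \<subseteq> S_LK2
    \<and> card (M_orbit (l3, {p\<^sub>0, p\<^sub>1})) = 960
    \<and> card (M_orbit (l6bar, {p\<^sub>0, p\<^sub>1})) = 960
    \<and> card (M_orbit (l1bar, {p\<^sub>0, p\<^sub>1})) = 960
    \<and> card (M_orbit (l4, {p\<^sub>0, n\<^sub>4})) = 480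
    \<and> card (M_orbit (l4bar, {p\<^sub>0, n\<^sub>4})) = 480
    \<and> card (M_orbit (l6bar, {p\<^sub>0, n\<^sub>4})) = 1920
    \<and> card (M_orbit (l6, {p\<^sub>0, n\<^sub>0})) = 192"
proof -
  let ?p0 = "{1, 2, 3, 4, 5, 6} :: int set"
  let ?p1 = "{3, -2, -1, 4, 5, 6} :: int set"
  let ?n0 = "{-1, -2, -3, -4, -5, -6} :: int set"
  let ?n4 = "{-1, -2, -3, -6, 5, 4} :: int set"
  define y1 y2 y3 y4 y5 y6 y7 :: "int \<times> int set set"
    where y_def: "y1 = (3, {?p0, ?p1})" "y2 = (- 6, {?p0, ?p1})" "y3 = (- 1, {?p0, ?p1})"
      "y4 = (4, {?p0, ?n4})" "y5 = (- 4, {?p0, ?n4})" "y6 = (- 6, {?p0, ?n4})" "y7 = (6, {?p0, ?n0})"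
  have reps: "(l3, {p\<^sub>0, p\<^sub>1}) = cosets_of y1" "(l6bar, {p\<^sub>0, p\<^sub>1}) = cosets_of y2"
    "(l1bar, {p\<^sub>0, p\<^sub>1}) = cosets_of y3" "(l4, {p\<^sub>0, n\<^sub>4}) = cosets_of y4"
    "(l4bar, {p\<^sub>0, n\<^sub>4}) = cosets_of y5" "(l6bar, {p\<^sub>0, n\<^sub>4}) = cosets_of y6"
    "(l6, {p\<^sub>0, n\<^sub>0}) = cosets_of y7"
    by (simp_all add: y_def cosets_of_def label_cosets)
  \<comment> \<open>The letter -1 lies in each of the other three transversals.\<close>
  have "?p0 \<noteq> T" if "- 1 \<in> T" for T
  proof
    assume "?p0 = T"
    then have "- 1 \<in> ?p0" using that by (simp only:)
    then show False by simp
  qed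
  then have neq: "?p0 \<noteq> ?p1" "?p0 \<noteq> ?n0" "?p0 \<noteq> ?n4" by simp_all
  have y: "y1 \<in> marked_pairs" "y2 \<in> marked_pairs" "y3 \<in> marked_pairs" "y4 \<in> marked_pairs"
    "y5 \<in> marked_pairs" "y6 \<in> marked_pairs" "y7 \<in> marked_pairs"
    unfolding y_def marked_pairs_def
    using neq explicit_even_transversals by (simp_all add: signed_def)
  have int: "?p0 \<inter> ?p1 = {3, 4, 5, 6}" "?p0 \<inter> ?n4 = {4, 5}" "?p0 \<inter> ?n0 = {}"
    by auto
  have kind: "kind y1 = (4, True, False)" "kind y2 = (4, False, True)" "kind y3 = (4, False, False)"
    "kind y4 = (2, True, False)" "kind y5 = (2, False, True)" "kind y6 = (2, False, False)"
    "kind y7 = (0, False, False)"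
    unfolding y_def kind_def by (simp_all add: int)
  let ?kinds = "kind ` {y1, y2, y3, y4, y5, y6, y7}"
  \<comment> \<open>The seven representatives realise every kind, so the kinds index the
    orbits.\<close>
  have kinds: "kind ` marked_pairs = ?kinds"
  proof
    show "kind ` marked_pairs \<subseteq> ?kinds"
      using kind_cases by (simp add: kind image_subset_iff)
  qed (use y in blast)
  have "orbits M S_LK2 right_mult = (\<lambda>y. M_orbit (cosets_of y)) ` marked_pairs"
    unfolding orbits_def S_LK2_eq by blast
  also have "\<dots> = (\<lambda>v. cosets_of ` of_kind v) ` kind ` marked_pairs"
    using M_orbit_cosets_of by (simp add: image_image)
  finally have orbits: "orbits M S_LK2 right_mult = (\<lambda>v. cosets_of ` of_kind v) ` ?kinds"
    unfolding kinds .
  also have "\<dots> = (\<lambda>y. M_orbit (cosets_of y)) ` {y1, y2, y3, y4, y5, y6, y7}"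
    using M_orbit_cosets_of y by (simp add: image_image)
  finally have orbits': "orbits M S_LK2 right_mult
    = (\<lambda>y. M_orbit (cosets_of y)) ` {y1, y2, y3, y4, y5, y6, y7}" .
  \<comment> \<open>Each of these kinds is realised, so its set of marked pairs is nonempty and any
    member gives the kind back.\<close>
  have "inj_on (\<lambda>v. cosets_of ` of_kind v) ?kinds"
  proof (rule inj_onI)
    fix v w assume v: "v \<in> ?kinds" and eq: "cosets_of ` of_kind v = cosets_of ` of_kind w"
    have same: "of_kind v = of_kind w"
      using eq inj_on_image_eq_iff[OF inj_on_cosets_of, of "of_kind v" "of_kind w"]
      by (auto simp: of_kind_def)
    obtain z where z: "z \<in> marked_pairs" "v = kind z"
      using v unfolding kinds[symmetric] by (rule imageE)
    then have "z \<in> of_kind v" by (simp add: of_kind_def)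
    then have "z \<in> of_kind w" unfolding same .
    then show "v = w" using z(2) by (simp add: of_kind_def)
  qed
  then have "card (orbits M S_LK2 right_mult) = card ?kinds"
    unfolding orbits by (rule card_image)
  also have "card ?kinds = 7" by (simp add: kind)
  finally have "card (orbits M S_LK2 right_mult) = 7" .
  moreover have "(\<lambda>y. cosets_of y) ` {y1, y2, y3, y4, y5, y6, y7} \<subseteq> S_LK2"
    unfolding S_LK2_eq using y by blast
  \<comment> \<open>The lengths are 16 * 15 * 4 three times, 16 * 15 * 2 twice, 16 * 15 * 8, and 16
    * 12.\<close>
  moreover have "6 choose 4 = (15::nat)" "6 choose 2 = (15::nat)"
    by (simp_all add: numeral_eq_Suc)
  ultimately show ?thesis
    unfolding reps orbits'
    by (simp add: card_M_orbit y kind card_of_kind)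
qed

end
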